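(* Let $n\in\mathbb{N}$, $\alpha\in(0,1)$, $p\in[1,+\infty]$, and set $p_\alpha=\frac{p}{1-\alpha+\alpha p}$ if $p\in[1,+\infty)$ and $p_\alpha=\frac1\alpha$ if $p=+\infty$. Then for every $f\in BV^{1,p}(\mathbb{R}^n)$ one has $\mathcal{D}^\alpha f\in L^{p_\alpha,\infty}(\mathbb{R}^n)$ and $$\|\mathcal{D}^\alpha f\|_{L^{p_\alpha,\infty}(\mathbb{R}^n)}\le c_{n,\alpha,p}\,\|f\|_{L^p(\mathbb{R}^n)}^{1-\alpha}\,|Df|(\mathbb{R}^n)^\alpha,$$ where $c_{n,\alpha,p}>0$ depends only on $n,\alpha,p$.
   Context: For a measurable $f:\mathbb{R}^n\to\mathbb{R}$, $\mathcal{D}^\alpha f(x)=\int_{\mathbb{R}^n}\frac{|f(x+h)-f(x)|}{|h|^{n+\alpha}}\,dh\in[0,+\infty]$. $L^{s,\infty}(\mathbb{R}^n)$ is the weak Lebesgue (Lorentz) space. $BV^{1,p}(\mathbb{R}^n)$ is the set of $f\in L^p(\mathbb{R}^n)$ whose distributional gradient $Df$ is a finite $\mathbb{R}^n$-valued Radon measure, with total variation $|Df|(\mathbb{R}^n)$. *)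

theory Defs
  imports "HOL-Analysis.Analysis"
begin

text \<open>Smooth (C-infinity) real functions on a Euclidean space: differentiable everywhere,
  and every partial derivative is again smooth (coinductively, i.e. all orders).\<close>
coinductive smooth_fun :: "('a::euclidean_space \<Rightarrow> real) \<Rightarrow> bool" where
  "(\<forall>x. f differentiable (at x)) \<Longrightarrow>
   (\<forall>b\<in>Basis. smooth_fun (\<lambda>x. frechet_derivative f (at x) b)) \<Longrightarrow> smooth_fun f"

definition test_fun :: "('a::euclidean_space \<Rightarrow> real) \<Rightarrow> bool" where
  "test_fun \<phi> \<longleftrightarrow> smooth_fun \<phi> \<and> compact (closure {x. \<phi> x \<noteq> 0})"

definition partial_deriv :: "('a::euclidean_space \<Rightarrow> real) \<Rightarrow> 'a \<Rightarrow> 'a \<Rightarrow> real" where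
  "partial_deriv \<phi> b x = frechet_derivative \<phi> (at x) b"

definition in_Lp :: "ereal \<Rightarrow> ('a::euclidean_space \<Rightarrow> real) \<Rightarrow> bool" where
  "in_Lp p f \<longleftrightarrow> f \<in> borel_measurable lebesgue \<and>
     (if p = \<infinity> then (\<exists>C. AE x in lebesgue. \<bar>f x\<bar> \<le> C)
      else integrable lebesgue (\<lambda>x. \<bar>f x\<bar> powr real_of_ereal p))"

text \<open>L^p norm (meaningful for f in L^p).\<close>
definition Lp_norm :: "ereal \<Rightarrow> ('a::euclidean_space \<Rightarrow> real) \<Rightarrow> real" where
  "Lp_norm p f = (if p = \<infinity> then Inf {C. C \<ge> 0 \<and> (AE x in lebesgue. \<bar>f x\<bar> \<le> C)}
      else (\<integral>x. \<bar>f x\<bar> powr real_of_ereal p \<partial>lebesgue) powr (1 / real_of_ereal p))"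

text \<open>A finite R^n-valued Borel (= Radon) measure is encoded componentwise, for each basis
  vector b, as a difference fst (mu b) - snd (mu b) of two finite positive Borel measures.\<close>
definition finite_vector_measure :: "('a::euclidean_space \<Rightarrow> 'a measure \<times> 'a measure) \<Rightarrow> bool" where
  "finite_vector_measure mu \<longleftrightarrow> (\<forall>b\<in>Basis.
      sets (fst (mu b)) = sets borel \<and> sets (snd (mu b)) = sets borel \<and>
      finite_measure (fst (mu b)) \<and> finite_measure (snd (mu b)))"

definition vmeasure :: "('a::euclidean_space \<Rightarrow> 'a measure \<times> 'a measure) \<Rightarrow> 'a set \<Rightarrow> 'a" where
  "vmeasure mu E = (\<Sum>b\<in>Basis. (measure (fst (mu b)) E - measure (snd (mu b)) E) *\<^sub>R b)"

definition total_variation :: "('a::euclidean_space \<Rightarrow> 'a measure \<times> 'a measure) \<Rightarrow> ennreal" where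
  "total_variation mu = (SUP E\<in>{E :: nat \<Rightarrow> 'a set. (\<forall>k. E k \<in> sets borel) \<and>
        disjoint_family E \<and> (\<Union>k. E k) = UNIV}.
      (\<Sum>k. ennreal (norm (vmeasure mu (E k)))))"

definition is_dist_gradient :: "('a::euclidean_space \<Rightarrow> real) \<Rightarrow> ('a \<Rightarrow> 'a measure \<times> 'a measure) \<Rightarrow> bool" where
  "is_dist_gradient f mu \<longleftrightarrow> finite_vector_measure mu \<and>
     (\<forall>\<phi>. test_fun \<phi> \<longrightarrow> (\<forall>b\<in>Basis.
        (\<integral>x. f x * partial_deriv \<phi> b x \<partial>lebesgue) =
        - ((\<integral>x. \<phi> x \<partial>fst (mu b)) - (\<integral>x. \<phi> x \<partial>snd (mu b)))))"

definition BV1p_with :: "ereal \<Rightarrow> ('a::euclidean_space \<Rightarrow> real) \<Rightarrow> ('a \<Rightarrow> 'a measure \<times> 'a measure) \<Rightarrow> bool" where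
  "BV1p_with p f mu \<longleftrightarrow> in_Lp p f \<and> is_dist_gradient f mu"

definition frac_D :: "real \<Rightarrow> ('a::euclidean_space \<Rightarrow> real) \<Rightarrow> 'a \<Rightarrow> ennreal" where
  "frac_D \<alpha> f x = (\<integral>\<^sup>+ h. ennreal (\<bar>f (x + h) - f x\<bar> / norm h powr (real DIM('a) + \<alpha>)) \<partial>lebesgue)"

definition enn_powr :: "ennreal \<Rightarrow> real \<Rightarrow> ennreal" where
  "enn_powr x q = (if x = \<infinity> then \<infinity> else ennreal (enn2real x powr q))"

definition weak_Lnorm :: "real \<Rightarrow> ('a::euclidean_space \<Rightarrow> ennreal) \<Rightarrow> ennreal" where
  "weak_Lnorm s g = (SUP t\<in>{0<..}. ennreal t * enn_powr (emeasure lebesgue {x. g x > ennreal t}) (1 / s))"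

definition in_weak_L :: "real \<Rightarrow> ('a::euclidean_space \<Rightarrow> ennreal) \<Rightarrow> bool" where
  "in_weak_L s g \<longleftrightarrow> g \<in> borel_measurable lebesgue \<and> weak_Lnorm s g < \<infinity>"

definition p_alpha :: "real \<Rightarrow> ereal \<Rightarrow> real" where
  "p_alpha \<alpha> p = (if p = \<infinity> then 1 / \<alpha>
     else real_of_ereal p / (1 - \<alpha> + \<alpha> * real_of_ereal p))"

end

theory Submission
  imports Defs
begin

text \<open>
  Split the integral defining the fractional operator at radius \<open>r\<close>.  If \<open>|Df|(B(x, s)) \<le> B s\<^sup>n\<close>
  for all \<open>s\<close>, then \<open>\<integral>\<^bsub>|h|<\<rho>\<^esub> |f (x + h) - f x| dh \<le> K B \<rho>\<^bsup>n+1\<^esup>\<close>: for mollifications of \<open>f\<close>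
  this is the fundamental theorem of calculus along segments, and Fatou's lemma passes to the limit
  at almost every \<open>x\<close>.  Summing over dyadic annuli bounds the part \<open>|h| < r\<close> by \<open>B r\<^bsup>1-\<alpha>\<^esup>\<close>.  If the
  averages of \<open>|f|\<close> on balls around \<open>x\<close> and \<open>|f x|\<close> itself are at most \<open>A\<close>, the part \<open>|h| \<ge> r\<close> is bounded by
  \<open>A r\<^bsup>-\<alpha>\<^esup>\<close>, and \<open>r = A/B\<close> gives the pointwise bound \<open>C A\<^bsup>1-\<alpha>\<^esup> B\<^bsup>\<alpha>\<^esup>\<close>.  By Vitali's covering lemma,
  applied to \<open>|Df|\<close> and to \<open>|f|\<^sup>p dx\<close>, these hypotheses hold outside a set of measure \<open>O(m)\<close> with
  \<open>B = |Df|/m\<close> and \<open>A = \<parallel>f\<parallel>\<^sub>p m\<^bsup>-1/p\<^esup>\<close>, and \<open>m\<close> is then chosen so that the pointwise bound is the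
  given level.
\<close>

section \<open>Smooth bump functions\<close>

text \<open>The hypothesis on \<open>f\<close> speaks only of pairings with smooth test functions,
  and \<open>total_variation mu\<close> is a number, not a measure. Hence explicit smooth bumps
  serve as mollifiers, and |Df| is replaced by a positive measure \<open>lam\<close>, built from the
  components of \<open>mu\<close>, which bounds those pairings ball by ball; its mass is at most n
  times the total variation. The bound for mollifications must not degenerate as the radius e tends
  to 0: the mass of the bump is at least a constant times e^n, which cancels the volume factor e^n
  produced by averaging \<open>lam\<close> over balls of radius e. Convergence is needed only almost
  everywhere along a subsequence, so L^1 convergence on balls is enough. The exceptional sets for
  \<open>lam\<close> and for |f|^p share the parameter m; the level m^(-1/p) for f and the level 1/m
  for \<open>lam\<close>, combined with weights 1 - \<alpha> and \<alpha>, give the power -1 /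
  \<open>p_alpha\<close> of m, and this is where the exponent of the theorem comes from.\<close>

definition exp_inv :: "nat \<Rightarrow> real \<Rightarrow> real" where
  "exp_inv k t = (if t > 0 then exp (- 1 / t) / t ^ k else 0)"

lemma exp_inv_nonneg: "0 \<le> exp_inv k t"
  by (simp add: exp_inv_def)

text \<open>With s = 1/t this is the decay of s^k / exp s. It supplies the derivatives at the gluing
  point 0.\<close>

lemma exp_inv_tendsto_0: "(exp_inv k \<longlongrightarrow> 0) (at 0)"
proof -
  have "((\<lambda>t. inverse t ^ k / exp (inverse t)) \<longlongrightarrow> (0::real)) (at_right 0)"
    by (rule filterlim_compose[OF tendsto_power_div_exp_0 filterlim_inverse_at_top_right])
  then have "(exp_inv k \<longlongrightarrow> 0) (at_right 0)"
    by (rule Lim_transform_eventually)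
       (auto simp: exp_inv_def eventually_at_filter exp_minus field_simps)
  moreover have "(exp_inv k \<longlongrightarrow> 0) (at_left 0)"
    by (rule tendsto_eventually) (auto simp: exp_inv_def eventually_at_filter)
  ultimately show ?thesis
    by (simp add: filterlim_split_at)
qed

text \<open>Differentiating exp (-1/t) / t^k only raises the power of 1/t, which is why a whole
  family indexed by \<open>k\<close> is introduced: all derivatives of the profile are combinations
  of its members. At 0 the difference quotient of index k is the member of index k + 1, which tends
  to 0.\<close>

lemma DERIV_exp_inv:
  "(exp_inv k has_real_derivative exp_inv (k + 2) t - real k * exp_inv (k + 1) t) (at t)"
proof (cases t "0::real" rule: linorder_cases)
  case less
  have "((\<lambda>_. 0) has_real_derivative 0) (at t)" by simp
  then have "(exp_inv k has_real_derivative 0) (at t)"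
    by (rule has_field_derivative_transform_within_open[of _ _ _ "{..<0}"])
       (use less in \<open>auto simp: exp_inv_def\<close>)
  then show ?thesis using less by (simp add: exp_inv_def)
next
  case equal
  have "((\<lambda>h. exp_inv (k + 1) h) \<longlongrightarrow> 0) (at 0)"
    using exp_inv_tendsto_0 by blast
  then have "((\<lambda>h. (exp_inv k (0 + h) - exp_inv k 0) / h) \<longlongrightarrow> 0) (at 0)"
    by (rule Lim_transform_eventually)
       (auto simp: exp_inv_def eventually_at_filter field_simps)
  then show ?thesis using equal by (simp add: DERIV_def exp_inv_def)
next
  case greater
  have "((\<lambda>t. exp (- 1 / t) / t ^ k) has_real_derivative
        exp_inv (k + 2) t - real k * exp_inv (k + 1) t) (at t)"
    using greater
    by (cases k)
       (auto intro!: derivative_eq_intros simp: exp_inv_def field_simps power2_eq_square,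
        metis One_nat_def power_eq_if)
  then show ?thesis
    by (rule has_field_derivative_transform_within_open[of _ _ _ "{0<..}"])
       (use greater in \<open>auto simp: exp_inv_def\<close>)
qed

text \<open>Closure of this class under partial derivatives is what makes the coinduction for
  smoothness go through.\<close>

inductive bump_algebra :: "'a::euclidean_space \<Rightarrow> real \<Rightarrow> ('a \<Rightarrow> real) \<Rightarrow> bool" for y e where
  const: "bump_algebra y e (\<lambda>_. c)"
| coord: "bump_algebra y e (\<lambda>x. x \<bullet> b)"
| gen: "bump_algebra y e (\<lambda>x. exp_inv k (1 - ((x - y) \<bullet> (x - y)) / e\<^sup>2))"
| add: "bump_algebra y e u \<Longrightarrow> bump_algebra y e v \<Longrightarrow> bump_algebra y e (\<lambda>x. u x + v x)"
| mult: "bump_algebra y e u \<Longrightarrow> bump_algebra y e v \<Longrightarrow> bump_algebra y e (\<lambda>x. u x * v x)"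

lemma has_derivative_bump_gen:
  fixes x y :: "'a::euclidean_space"
  shows "((\<lambda>x. exp_inv k (1 - ((x - y) \<bullet> (x - y)) / e\<^sup>2)) has_derivative
     (\<lambda>h. (exp_inv (k + 2) (1 - ((x - y) \<bullet> (x - y)) / e\<^sup>2)
            - real k * exp_inv (k + 1) (1 - ((x - y) \<bullet> (x - y)) / e\<^sup>2))
          * (- 2 * ((x - y) \<bullet> h) / e\<^sup>2))) (at x)"
proof -
  have "((\<lambda>x. 1 - ((x - y) \<bullet> (x - y)) / e\<^sup>2) has_derivative (\<lambda>h. - 2 * ((x - y) \<bullet> h) / e\<^sup>2)) (at x)"
  proof -
    have "((\<lambda>x. (x - y) \<bullet> (x - y)) has_derivative (\<lambda>h. 2 * ((x - y) \<bullet> h))) (at x)"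
      by (auto intro!: derivative_eq_intros simp: inner_commute)
    from has_derivative_diff[OF has_derivative_const[of 1] has_derivative_mult_right[OF this, of "1 / e\<^sup>2"]]
    show ?thesis by simp
  qed
  from DERIV_compose_FDERIV[OF DERIV_exp_inv this, of k] show ?thesis
    by (simp add: mult.commute)
qed

lemma bump_algebra_has_derivative:
  assumes "bump_algebra y e u"
  shows "\<exists>D. \<forall>x. (u has_derivative D x) (at x) \<and> (\<forall>b. bump_algebra y e (\<lambda>x. D x b))"
  using assms
proof induction
  case (const c)
  show ?case
    by (rule exI[of _ "\<lambda>x h. 0"]) (auto intro: bump_algebra.const)
next
  case (coord b)
  show ?case
    by (rule exI[of _ "\<lambda>x h. h \<bullet> b"])
       (auto intro!: bump_algebra.const derivative_eq_intros)
next
  case (gen k)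
  let ?g = "\<lambda>k x. exp_inv k (1 - ((x - y) \<bullet> (x - y)) / e\<^sup>2)"
  \<comment> \<open>Only linear coordinates are generators, so the inner product with
    \<open>x - y\<close> is split into a coordinate and a constant.\<close>
  have *: "- 2 * ((x - y) \<bullet> b) / e\<^sup>2 = (- 2 / e\<^sup>2) * (x \<bullet> b + - (y \<bullet> b))" for x b
    by (simp add: inner_diff_left algebra_simps diff_divide_distrib)
  have "bump_algebra y e (\<lambda>x. ?g (k + 2) x - real k * ?g (k + 1) x)"
    using bump_algebra.add[OF bump_algebra.gen[of y e "k + 2"]
            bump_algebra.mult[OF bump_algebra.const[of y e "- real k"] bump_algebra.gen[of y e "k + 1"]]]
    by simp
  then have "bump_algebra y e
      (\<lambda>x. (?g (k + 2) x - real k * ?g (k + 1) x) * (- 2 * ((x - y) \<bullet> b) / e\<^sup>2))" for b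
    unfolding * by (intro bump_algebra.mult bump_algebra.add bump_algebra.coord bump_algebra.const)
  then show ?case
    by (intro exI[of _ "\<lambda>x h. (?g (k + 2) x - real k * ?g (k + 1) x) * (- 2 * ((x - y) \<bullet> h) / e\<^sup>2)"]
          allI conjI has_derivative_bump_gen)
next
  case (add u v)
  then obtain D E where
    "\<And>x. (u has_derivative D x) (at x)" "\<And>b. bump_algebra y e (\<lambda>x. D x b)"
    "\<And>x. (v has_derivative E x) (at x)" "\<And>b. bump_algebra y e (\<lambda>x. E x b)" by metis
  then show ?case
    by (intro exI[of _ "\<lambda>x h. D x h + E x h"] allI conjI has_derivative_add bump_algebra.add)
next
  case (mult u v)
  then obtain D E where
    "\<And>x. (u has_derivative D x) (at x)" "\<And>b. bump_algebra y e (\<lambda>x. D x b)"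
    "\<And>x. (v has_derivative E x) (at x)" "\<And>b. bump_algebra y e (\<lambda>x. E x b)" by metis
  with mult.hyps show ?case
    by (intro exI[of _ "\<lambda>x h. u x * E x h + D x h * v x"] allI conjI has_derivative_mult
          bump_algebra.add bump_algebra.mult)
qed

lemma bump_algebra_imp_smooth:
  assumes "bump_algebra y e u"
  shows "smooth_fun u"
  using assms
proof (coinduction arbitrary: u)
  case smooth_fun
  obtain D where D: "\<And>x. (u has_derivative D x) (at x)" "\<And>b. bump_algebra y e (\<lambda>x. D x b)"
    using bump_algebra_has_derivative[OF smooth_fun] by metis
  have "frechet_derivative u (at x) = D x" for x
    using frechet_derivative_at[OF D(1)] by simp
  with D show ?case
    unfolding differentiable_def by auto
qed

text \<open>The classical mollifier profile exp (-1 / (1 - |x-y|^2/e^2)), left unnormalised so that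
  its values lie in [0, 1]: a signed measure tested against it is then controlled by the variation
  of the ball with constant 1. The normalisation is left to \<open>mollify\<close>.\<close>

definition bump :: "real \<Rightarrow> 'a::euclidean_space \<Rightarrow> 'a \<Rightarrow> real" where
  "bump e y x = exp_inv 0 (1 - ((x - y) \<bullet> (x - y)) / e\<^sup>2)"

text \<open>The gradient of the bump centred at \<open>y\<close> is \<open>bump' e y x *\<^sub>R (x - y)\<close>.\<close>

definition bump' :: "real \<Rightarrow> 'a::euclidean_space \<Rightarrow> 'a \<Rightarrow> real" where
  "bump' e y x = exp_inv 2 (1 - ((x - y) \<bullet> (x - y)) / e\<^sup>2) * (- 2 / e\<^sup>2)"

lemma has_derivative_bump: "(bump e y has_derivative (\<lambda>h. bump' e y x * ((x - y) \<bullet> h))) (at x)"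
  using has_derivative_bump_gen[of 0 y e x] by (simp add: bump_def[abs_def] bump'_def ac_simps numeral_2_eq_2)

lemma partial_deriv_bump: "partial_deriv (bump e y) b x = bump' e y x * ((x - y) \<bullet> b)"
  unfolding partial_deriv_def using frechet_derivative_at[OF has_derivative_bump] by metis

lemma bump_arg_pos_iff:
  assumes "0 < e" shows "0 < 1 - ((x - y) \<bullet> (x - y)) / e\<^sup>2 \<longleftrightarrow> dist x y < e"
proof -
  have "0 < 1 - ((x - y) \<bullet> (x - y)) / e\<^sup>2 \<longleftrightarrow> (norm (x - y))\<^sup>2 < e\<^sup>2"
    using assms by (simp add: power2_norm_eq_inner)
  also have "\<dots> \<longleftrightarrow> dist x y < e"
    using assms power2_less_imp_less[of "norm (x - y)" e] power_strict_mono[of "norm (x - y)" e 2]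
    by (auto simp: dist_norm)
  finally show ?thesis .
qed

lemma bump_eq_0: "0 < e \<Longrightarrow> x \<notin> ball y e \<Longrightarrow> bump e y x = 0"
  using bump_arg_pos_iff[of e x y] by (auto simp: bump_def exp_inv_def dist_commute)

lemma bump'_eq_0: "0 < e \<Longrightarrow> x \<notin> ball y e \<Longrightarrow> bump' e y x = 0"
  using bump_arg_pos_iff[of e x y] by (auto simp: bump'_def exp_inv_def dist_commute)

lemma bump_nonneg: "0 \<le> bump e y x"
  by (simp add: bump_def exp_inv_nonneg)

lemma bump_le_1: "bump e y x \<le> 1"
  by (auto simp: bump_def exp_inv_def)

lemma bump_ge:
  assumes "0 < e" "x \<in> cball y (e / 2)"
  shows "exp (- 2) \<le> bump e y x"
proof -
  have "(norm (x - y))\<^sup>2 \<le> (e / 2)\<^sup>2"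
    using assms by (intro power_mono) (auto simp: dist_norm norm_minus_commute)
  \<comment> \<open>The quantity is even at least 3/4; the value 1/2 gives exp (-1 / (1/2)) = exp
    (-2), the source of the factor \<open>exp 2\<close> in the later constants.\<close>
  then have "1 - ((x - y) \<bullet> (x - y)) / e\<^sup>2 \<ge> 1 / 2"
    using assms by (simp add: power2_norm_eq_inner field_simps)
      (smt (verit) inner_ge_zero)
  then show ?thesis
    by (auto simp: bump_def exp_inv_def field_simps)
qed

lemma test_fun_bump:
  assumes "0 < e" shows "test_fun (bump e y)"
proof -
  have "smooth_fun (bump e y)"
    using bump_algebra_imp_smooth[OF bump_algebra.gen[of y e 0]] by (simp add: bump_def[abs_def])
  moreover have "bounded {x. bump e y x \<noteq> 0}"
    by (rule bounded_subset[OF bounded_ball[of y e]]) (use bump_eq_0[OF assms] in blast)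
  ultimately show ?thesis
    by (simp add: test_fun_def)
qed

lemma continuous_exp_inv: "continuous_on UNIV (exp_inv k)"
  by (rule DERIV_continuous_on[OF has_field_derivative_at_within[OF DERIV_exp_inv]])

lemma borel_measurable_bump [measurable]:
  fixes f g :: "'b \<Rightarrow> 'a::euclidean_space"
  assumes [measurable]: "f \<in> borel_measurable M" "g \<in> borel_measurable M"
  shows "(\<lambda>x. bump e (f x) (g x)) \<in> borel_measurable M"
    and "(\<lambda>x. bump' e (f x) (g x)) \<in> borel_measurable M"
proof -
  have "exp_inv k \<in> borel_measurable borel" for k
    using continuous_exp_inv borel_measurable_continuous_onI by blast
  note [measurable] = this
  show "(\<lambda>x. bump e (f x) (g x)) \<in> borel_measurable M"
    and "(\<lambda>x. bump' e (f x) (g x)) \<in> borel_measurable M"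
    unfolding bump_def bump'_def by measurable
qed

section \<open>A positive measure dominating the gradient\<close>

text \<open>Restricting both measures to \<open>S\<close> by indicator densities turns the
  comparison on subsets of \<open>S\<close> into one on all Borel sets. Boundedness of
  \<open>g\<close> gives integrability, so the nonnegative integrals can be read as real
  ones.\<close>

lemma integral_mono_measure_on:
  fixes g :: "'a::euclidean_space \<Rightarrow> real"
  assumes M: "sets M = sets borel" "finite_measure M"
    and N: "sets N = sets borel" "finite_measure N"
    and S: "S \<in> sets borel" and le: "\<And>X. X \<in> sets borel \<Longrightarrow> X \<subseteq> S \<Longrightarrow> emeasure N X \<le> emeasure M X"
    and g[measurable]: "g \<in> borel_measurable borel"
    and g0: "\<And>x. 0 \<le> g x" "\<And>x. g x \<le> c" "\<And>x. x \<notin> S \<Longrightarrow> g x = 0"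
  shows "(\<integral>x. g x \<partial>N) \<le> (\<integral>x. g x \<partial>M)"
proof -
  interpret M: finite_measure M by fact
  interpret N: finite_measure N by fact
  note [measurable_cong] = M(1) N(1)
  note [measurable] = S
  let ?M = "density M (indicator S)" and ?N = "density N (indicator S)"
  have "emeasure ?N A \<le> emeasure ?M A" if "A \<in> sets borel" for A
    using that le[of "S \<inter> A"] M N S by (simp add: emeasure_restricted)
  then have "nn_integral ?N (\<lambda>x. ennreal (g x)) \<le> nn_integral ?M (\<lambda>x. ennreal (g x))"
    by (intro nn_integral_mono_measure) (simp_all add: M N le_measure)
  moreover have "nn_integral ?M (\<lambda>x. ennreal (g x)) = (\<integral>\<^sup>+x. g x \<partial>M)"
    by (subst nn_integral_density) (auto intro!: nn_integral_cong simp: g0 indicator_def)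
  moreover have "nn_integral ?N (\<lambda>x. ennreal (g x)) = (\<integral>\<^sup>+x. g x \<partial>N)"
    by (subst nn_integral_density) (auto intro!: nn_integral_cong simp: g0 indicator_def)
  moreover have "integrable M g" "integrable N g"
    using g0 by (auto intro!: M.integrable_const_bound[of _ c] N.integrable_const_bound[of _ c])
  ultimately show ?thesis
    using g0 by (simp add: nn_integral_eq_integral integral_nonneg_AE)
qed

text \<open>On the set \<open>Y\<close>, where M - N is positive, the signed integral can only grow
  when \<phi> is raised to \<open>c\<close> on \<open>B\<close>; off \<open>Y\<close>, where it is
  negative, when \<phi> is lowered to 0. The functions \<open>v\<close> and \<open>u\<close> below
  are these two corrections, both nonnegative.\<close>

lemma signed_integral_le:
  fixes \<phi> :: "'a::euclidean_space \<Rightarrow> real"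
  assumes M: "sets M = sets borel" "finite_measure M"
    and N: "sets N = sets borel" "finite_measure N"
    and Y: "Y \<in> sets borel"
    and pos: "\<And>X. X \<in> sets borel \<Longrightarrow> X \<subseteq> Y \<Longrightarrow> emeasure N X \<le> emeasure M X"
    and neg: "\<And>X. X \<in> sets borel \<Longrightarrow> X \<subseteq> - Y \<Longrightarrow> emeasure M X \<le> emeasure N X"
    and \<phi>[measurable]: "\<phi> \<in> borel_measurable borel" and B: "B \<in> sets borel"
    and bd: "\<And>x. 0 \<le> \<phi> x" "\<And>x. \<phi> x \<le> c * indicator B x" and c: "0 \<le> c"
  shows "(\<integral>x. \<phi> x \<partial>M) - (\<integral>x. \<phi> x \<partial>N) \<le> c * (measure M (B \<inter> Y) - measure N (B \<inter> Y))"
proof -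
  interpret M: finite_measure M by fact
  interpret N: finite_measure N by fact
  note [measurable_cong] = M(1) N(1)
  note [measurable] = Y B
  have \<phi>c: "\<phi> x \<le> c" for x
    using bd(2)[of x] c by (cases "x \<in> B") auto
  define u where "u x = \<phi> x * indicator (- Y) x" for x
  define v where "v x = (c * indicator B x - \<phi> x) * indicator Y x" for x
  have [measurable]: "u \<in> borel_measurable borel" "v \<in> borel_measurable borel"
    by (auto simp: u_def[abs_def] v_def[abs_def])
  have vc: "v x \<le> c" "0 \<le> v x" "u x \<le> c" "0 \<le> u x" for x
    using bd[of x] c \<phi>c[of x] by (auto simp: v_def u_def split: split_indicator)
  have int: "integrable M (\<lambda>x. c * indicator (B \<inter> Y) x)" "integrable N (\<lambda>x. c * indicator (B \<inter> Y) x)"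
    by (intro integrable_mult_right integrable_real_indicator; simp add: less_top[symmetric])+
  have int': "integrable M u" "integrable N u" "integrable M v" "integrable N v"
    using vc by (auto intro!: M.integrable_const_bound[of _ c] N.integrable_const_bound[of _ c])
  have "(\<integral>x. u x \<partial>M) \<le> (\<integral>x. u x \<partial>N)"
    using vc by (intro integral_mono_measure_on[OF N M, of "- Y" u c] neg) (auto simp: u_def)
  moreover have "(\<integral>x. v x \<partial>N) \<le> (\<integral>x. v x \<partial>M)"
    using vc by (intro integral_mono_measure_on[OF M N, of "Y" v c] pos) (auto simp: v_def)
  moreover have eq: "\<phi> x = u x + (c * indicator (B \<inter> Y) x - v x)" for x
    by (auto simp: u_def v_def indicator_def)
  have "(\<integral>x. \<phi> x \<partial>M) = (\<integral>x. u x \<partial>M) + (c * measure M (B \<inter> Y) - (\<integral>x. v x \<partial>M))"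
    unfolding eq using int int' M N by (simp add: Bochner_Integration.integral_add Bochner_Integration.integral_diff)
  moreover have "(\<integral>x. \<phi> x \<partial>N) = (\<integral>x. u x \<partial>N) + (c * measure N (B \<inter> Y) - (\<integral>x. v x \<partial>N))"
    unfolding eq using int int' M N by (simp add: Bochner_Integration.integral_add Bochner_Integration.integral_diff)
  ultimately show ?thesis
    by (simp add: algebra_simps)
qed

text \<open>Guarantees that \<open>enn2real (total_variation mu)\<close> is the true value and not
  the default 0 at infinity. Each term of a partition is at most the sum of the masses of all
  component measures, and these masses add up over the partition.\<close>

lemma total_variation_finite:
  fixes mu :: "'a::euclidean_space \<Rightarrow> 'a measure \<times> 'a measure"
  assumes "finite_vector_measure mu"
  shows "total_variation mu < \<infinity>"
proof -
  let ?m = "\<lambda>b A. emeasure (fst (mu b)) A + emeasure (snd (mu b)) A"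
  have fin: "finite_measure (fst (mu b))" "finite_measure (snd (mu b))"
    "sets (fst (mu b)) = sets borel" "sets (snd (mu b)) = sets borel" if "b \<in> Basis" for b
    using assms that by (auto simp: finite_vector_measure_def)
  have "total_variation mu \<le> (\<Sum>b\<in>Basis. ?m b UNIV)"
    unfolding total_variation_def
  proof (rule SUP_least, clarify)
    fix E :: "nat \<Rightarrow> 'a set"
    assume E: "\<forall>k. E k \<in> sets borel" "disjoint_family E" "(\<Union>k. E k) = UNIV"
    have "ennreal (norm (vmeasure mu (E k))) \<le> (\<Sum>b\<in>Basis. ?m b (E k))" for k
    proof -
      have "norm (vmeasure mu (E k)) \<le> (\<Sum>b\<in>Basis. measure (fst (mu b)) (E k) + measure (snd (mu b)) (E k))"
        unfolding vmeasure_def by (rule sum_norm_le) (auto simp: abs_le_iff add.commute add_increasing)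
      also have "ennreal \<dots> = (\<Sum>b\<in>Basis. ?m b (E k))"
        by (subst sum_ennreal[symmetric])
           (auto intro!: sum.cong simp: finite_measure.emeasure_eq_measure fin)
      finally show ?thesis by (simp add: ennreal_leI)
    qed
    then have "(\<Sum>k. ennreal (norm (vmeasure mu (E k)))) \<le> (\<Sum>k. \<Sum>b\<in>Basis. ?m b (E k))"
      by (intro suminf_le) auto
    also have "\<dots> = (\<Sum>b\<in>Basis. (\<Sum>k. ?m b (E k)))"
      by (rule suminf_sum) auto
    also have "\<dots> = (\<Sum>b\<in>Basis. ?m b UNIV)"
    proof (rule sum.cong[OF refl])
      fix b :: 'a assume b: "b \<in> Basis"
      have "(\<Sum>k. ?m b (E k)) = (\<Sum>k. emeasure (fst (mu b)) (E k)) + (\<Sum>k. emeasure (snd (mu b)) (E k))"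
        by (rule suminf_add[symmetric]) auto
      also have "\<dots> = ?m b (\<Union>k. E k)"
        using E fin[OF b] by (intro arg_cong2[where f="(+)"] suminf_emeasure) auto
      finally show "(\<Sum>k. ?m b (E k)) = ?m b UNIV" using E by simp
    qed
    finally show "(\<Sum>k. ennreal (norm (vmeasure mu (E k)))) \<le> (\<Sum>b\<in>Basis. ?m b UNIV)" .
  qed
  also have "\<dots> < \<infinity>"
    using fin by (auto simp: finite_measure.emeasure_eq_measure)
  finally show ?thesis .
qed

text \<open>The partition into \<open>Y\<close> and its complement, padded with empty sets, competes
  in the supremum, and a component is at most the norm of the vector. With a Hahn set for
  \<open>Y\<close>, the left side is the total variation of component \<open>b\<close>.\<close>

lemma Hahn_pair_le_total_variation:
  fixes mu :: "'a::euclidean_space \<Rightarrow> 'a measure \<times> 'a measure"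
  assumes Y: "Y \<in> sets borel" and b: "b \<in> Basis"
  shows "ennreal (\<bar>measure (fst (mu b)) Y - measure (snd (mu b)) Y\<bar>
      + \<bar>measure (fst (mu b)) (- Y) - measure (snd (mu b)) (- Y)\<bar>) \<le> total_variation mu"
proof -
  have comp: "\<bar>measure (fst (mu b)) A - measure (snd (mu b)) A\<bar> \<le> norm (vmeasure mu A)" for A
  proof -
    have "vmeasure mu A \<bullet> b = measure (fst (mu b)) A - measure (snd (mu b)) A"
      using b by (simp add: vmeasure_def inner_sum_left_Basis)
    then show ?thesis using Basis_le_norm[OF b, of "vmeasure mu A"] by simp
  qed
  define E where "E = (\<lambda>k::nat. if k = 0 then Y else if k = 1 then - Y else {})"
  have "ennreal (\<bar>measure (fst (mu b)) Y - measure (snd (mu b)) Y\<bar>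
      + \<bar>measure (fst (mu b)) (- Y) - measure (snd (mu b)) (- Y)\<bar>)
      \<le> ennreal (norm (vmeasure mu (E 0)) + norm (vmeasure mu (E 1)))"
    by (intro ennreal_leI add_mono) (auto simp: E_def comp)
  also have "\<dots> = (\<Sum>k<2. ennreal (norm (vmeasure mu (E k))))"
    by (simp add: numeral_2_eq_2)
  also have "\<dots> \<le> (\<Sum>k. ennreal (norm (vmeasure mu (E k))))"
    by (rule sum_le_suminf) auto
  also have "\<dots> \<le> total_variation mu"
    unfolding total_variation_def
  proof (rule SUP_upper, clarify, intro conjI)
    show "\<forall>k. E k \<in> sets borel" using Y by (auto simp: E_def)
    show "disjoint_family E" by (auto simp: disjoint_family_on_def E_def)
    have "UNIV \<subseteq> E 0 \<union> E 1" by (auto simp: E_def)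
    then show "\<Union> (range E) = UNIV" by blast
  qed
  finally show ?thesis .
qed

text \<open>\<open>lam\<close> is the sum over the basis of the variation measures of the
  components, each obtained from a Hahn decomposition. It stands in for |Df|: a pairing with a
  function between 0 and c supported in \<open>B\<close> is at most
  \<open>c * measure lam B\<close>. The factor n in the mass arises because each component varies by
  at most the total variation.\<close>

lemma dominating_measure:
  fixes mu :: "'a::euclidean_space \<Rightarrow> 'a measure \<times> 'a measure"
  assumes "finite_vector_measure mu"
  obtains lam where "sets lam = sets (borel :: 'a measure)" "finite_measure lam"
    "emeasure lam UNIV \<le> of_nat DIM('a) * total_variation mu"
    "\<forall>b\<in>Basis. \<forall>\<phi>\<in>borel_measurable borel. \<forall>B\<in>sets borel. \<forall>c\<ge>0.
        (\<forall>x. 0 \<le> \<phi> x \<and> \<phi> x \<le> c * indicator B x) \<longrightarrow>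
        \<bar>(\<integral>x. \<phi> x \<partial>fst (mu b)) - (\<integral>x. \<phi> x \<partial>snd (mu b))\<bar> \<le> c * measure lam B"
proof -
  have fin: "finite_measure (fst (mu b))" "finite_measure (snd (mu b))"
    "sets (fst (mu b)) = sets borel" "sets (snd (mu b)) = sets borel" if "b \<in> Basis" for b
    using assms that by (auto simp: finite_vector_measure_def)
  have "\<exists>Y. b \<in> Basis \<longrightarrow> Y \<in> sets borel \<and> 
     (\<forall>X\<in>sets borel. X \<subseteq> Y \<longrightarrow> emeasure (snd (mu b)) X \<le> emeasure (fst (mu b)) X) \<and>
     (\<forall>X\<in>sets borel. X \<subseteq> - Y \<longrightarrow> emeasure (fst (mu b)) X \<le> emeasure (snd (mu b)) X)" for b
    using finite_unsigned_Hahn_decomposition[of "fst (mu b)" "snd (mu b)"] fin[of b]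
    by (auto simp: disjoint_eq_subset_Compl)
  then obtain Y where Y: "\<And>b. b \<in> Basis \<Longrightarrow> Y b \<in> sets borel"
    and pos: "\<And>b X. b \<in> Basis \<Longrightarrow> X \<in> sets borel \<Longrightarrow> X \<subseteq> Y b \<Longrightarrow> emeasure (snd (mu b)) X \<le> emeasure (fst (mu b)) X"
    and neg: "\<And>b X. b \<in> Basis \<Longrightarrow> X \<in> sets borel \<Longrightarrow> X \<subseteq> - Y b \<Longrightarrow> emeasure (fst (mu b)) X \<le> emeasure (snd (mu b)) X"
    by metis
  let ?M = "\<lambda>b. measure (fst (mu b))" and ?N = "\<lambda>b. measure (snd (mu b))"
  \<comment> \<open>\<open>p b\<close> and \<open>q b\<close> are the positive and negative parts in
    the Jordan decomposition of component \<open>b\<close>; \<open>v\<close> adds up the resulting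
    variations.\<close>
  define p where "p b A = ?M b (A \<inter> Y b) - ?N b (A \<inter> Y b)" for b A
  define q where "q b A = ?N b (A \<inter> - Y b) - ?M b (A \<inter> - Y b)" for b A
  define v where "v A = (\<Sum>b\<in>Basis. p b A + q b A)" for A
  have p0: "0 \<le> p b A" and q0: "0 \<le> q b A" if "b \<in> Basis" "A \<in> sets borel" for b A
    using pos[OF that(1), of "A \<inter> Y b"] neg[OF that(1), of "A \<inter> - Y b"] that fin[of b] Y
    by (auto simp: p_def q_def finite_measure.emeasure_eq_measure)
  have v0: "0 \<le> v A" if "A \<in> sets borel" for A
    using p0 q0 that by (auto simp: v_def intro!: sum_nonneg add_nonneg_nonneg)
  \<comment> \<open>The set function is made of real numbers, because \<open>p\<close> and
    \<open>q\<close> are differences of measures. Countable additivity is therefore proved for real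
    series and carried over to \<open>ennreal\<close> by nonnegativity.\<close>
  define lam where "lam = measure_of UNIV (sets borel) (\<lambda>A. ennreal (v A))"
  have sets: "sets lam = sets borel"
    unfolding lam_def using sets.sigma_sets_eq[of "borel :: 'a measure"] by simp
  have em: "emeasure lam A = ennreal (v A)" if A: "A \<in> sets borel" for A
    unfolding lam_def
  proof (rule emeasure_measure_of_sigma)
    show "sigma_algebra (UNIV :: 'a set) (sets borel)"
      using sets.sigma_algebra_axioms[of "borel :: 'a measure"] by simp
    show "positive (sets borel) (\<lambda>A. ennreal (v A))"
      by (simp add: positive_def v_def p_def q_def)
    show "countably_additive (sets borel) (\<lambda>A. ennreal (v A))"
    proof (rule countably_additiveI)
      fix E :: "nat \<Rightarrow> 'a set"
      assume E: "range E \<subseteq> sets borel" "disjoint_family E" "(\<Union>k. E k) \<in> sets borel"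
      have *: "(\<lambda>k. measure M (E k \<inter> S)) sums measure M ((\<Union>k. E k) \<inter> S)"
        if "finite_measure M" "sets M = sets borel" "S \<in> sets borel" for M and S :: "'a set"
      proof -
        have "(\<lambda>k. measure M (E k \<inter> S)) sums measure M (\<Union>k. E k \<inter> S)"
          using E that
          by (intro finite_measure.finite_measure_UNION) (auto simp: disjoint_family_on_def)
        moreover have "(\<Union>k. E k \<inter> S) = (\<Union>k. E k) \<inter> S" by blast
        ultimately show ?thesis by simp
      qed
      have "(\<lambda>k. v (E k)) sums v (\<Union>k. E k)"
        unfolding v_def p_def q_def
        using fin Y by (intro sums_sum sums_add sums_diff *) auto
      then show "(\<Sum>k. ennreal (v (E k))) = ennreal (v (\<Union>k. E k))"
        using E by (intro suminf_ennreal_eq v0) auto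
    qed
    show "A \<in> sets borel" by fact
  qed
  have space: "space lam = UNIV"
    using sets_eq_imp_space_eq[OF sets] by simp
  have fin_lam: "finite_measure lam"
    by (rule finite_measureI) (simp add: space em)
  have mass: "emeasure lam UNIV \<le> of_nat DIM('a) * total_variation mu"
  proof -
    have "emeasure lam UNIV = (\<Sum>b\<in>Basis. ennreal (p b UNIV + q b UNIV))"
      using p0 q0 by (subst sum_ennreal) (auto simp: em v_def)
    also have "\<dots> \<le> (\<Sum>b\<in>(Basis::'a set). total_variation mu)"
    proof (rule sum_mono)
      fix b :: 'a assume b: "b \<in> Basis"
      have "p b UNIV + q b UNIV \<le> \<bar>?M b (Y b) - ?N b (Y b)\<bar> + \<bar>?M b (- Y b) - ?N b (- Y b)\<bar>"
        by (simp add: p_def q_def)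
      then show "ennreal (p b UNIV + q b UNIV) \<le> total_variation mu"
        using Hahn_pair_le_total_variation[OF Y[OF b] b, of mu] by (meson ennreal_leI order_trans)
    qed
    finally show ?thesis by simp
  qed
  have dom: "\<bar>(\<integral>x. \<phi> x \<partial>fst (mu b)) - (\<integral>x. \<phi> x \<partial>snd (mu b))\<bar> \<le> c * measure lam B"
    if b: "b \<in> Basis" and \<phi>: "\<phi> \<in> borel_measurable borel" "B \<in> sets borel"
        "\<And>x. 0 \<le> \<phi> x" "\<And>x. \<phi> x \<le> c * indicator B x" "0 \<le> c" for b \<phi> B c
  proof -
    have pq: "p b B + q b B \<le> v B"
      unfolding v_def using p0 q0 b \<phi>(2)
      by (intro member_le_sum[of b _ "\<lambda>b. p b B + q b B"]) (auto intro!: add_nonneg_nonneg)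
    have "measure lam B = v B"
      using em[OF \<phi>(2)] v0[OF \<phi>(2)] by (simp add: measure_def)
    with pq p0[OF b \<phi>(2)] q0[OF b \<phi>(2)] have "p b B \<le> measure lam B" "q b B \<le> measure lam B"
      by auto
    moreover have "(\<integral>x. \<phi> x \<partial>fst (mu b)) - (\<integral>x. \<phi> x \<partial>snd (mu b)) \<le> c * p b B"
      unfolding p_def using fin[OF b] Y[OF b] pos[OF b] neg[OF b] \<phi>
      by (intro signed_integral_le) auto
    moreover have "(\<integral>x. \<phi> x \<partial>snd (mu b)) - (\<integral>x. \<phi> x \<partial>fst (mu b)) \<le> c * q b B"
      unfolding q_def using fin[OF b] Y[OF b] pos[OF b] neg[OF b] \<phi>
      by (intro signed_integral_le) auto
    ultimately show ?thesis
      using mult_left_mono[OF _ \<phi>(5), of "p b B" "measure lam B"]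
        mult_left_mono[OF _ \<phi>(5), of "q b B" "measure lam B"] by (simp add: abs_le_iff)
  qed
  show ?thesis
    by (rule that[OF sets fin_lam mass], intro ballI allI impI dom) auto
qed

section \<open>Weak-type bound and dyadic annuli\<close>

lemma sets_borel_balls [measurable]: "ball x r \<in> sets borel" "cball x r \<in> sets borel"
  by auto

text \<open>The Hardy-Littlewood argument: a disjoint subfamily of the bad balls covers all of them
  after a fivefold enlargement. Each enlarged ball has volume at most 5^n \<omega> / t times the
  nu-mass of the original (\<omega> the volume of the unit ball), and by disjointness these masses
  add up to at most the total. Stating the result with an open superset spares a proof that the bad
  set is measurable.\<close>

lemma maximal_function_weak_type:
  fixes nu :: "'a::euclidean_space measure"
  assumes nu: "sets nu = sets borel" "finite_measure nu" and t: "0 < t"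
  obtains U where "open U" "{x. \<exists>r>0. t * r ^ DIM('a) < measure nu (cball x r)} \<subseteq> U"
    "emeasure lborel U \<le> ennreal (5 ^ DIM('a) * unit_ball_vol DIM('a) / t) * emeasure nu UNIV"
proof -
  interpret nu: finite_measure nu by fact
  have space: "space nu = UNIV" using sets_eq_imp_space_eq[OF nu(1)] by simp
  define K where "K = {(x, r). 0 < r \<and> t * r ^ DIM('a) < measure nu (cball (x::'a) r)}"
  \<comment> \<open>Vitali's lemma requires bounded radii. For r \<ge> 1 one has r \<le> r^n, so
    finiteness of \<open>nu\<close> bounds r; smaller radii are covered by the 1 in the
    maximum.\<close>
  have bound: "0 < snd i \<and> snd i \<le> max 1 (measure nu UNIV / t)" if i: "i \<in> K" for i
  proof -
    obtain x r where xr: "i = (x, r)" "0 < r" "t * r ^ DIM('a) < measure nu (cball x r)"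
      using i by (auto simp: K_def)
    have "t * r ^ DIM('a) \<le> measure nu UNIV"
      using xr nu.bounded_measure[of "cball x r"] by (simp add: space)
    moreover have "r \<le> r ^ DIM('a)" if "1 \<le> r"
      using power_increasing[of 1 "DIM('a)" r] that by (simp add: Suc_leI)
    ultimately have "t * r \<le> measure nu UNIV" if "1 \<le> r"
      using that t by (meson mult_left_mono less_imp_le order_trans)
    then have "r \<le> measure nu UNIV / t" if "1 \<le> r"
      using that t by (simp add: pos_le_divide_eq mult.commute)
    with xr show ?thesis by (cases "1 \<le> r") auto
  qed
  obtain C where C: "countable C" "C \<subseteq> K"
    and disj: "pairwise (\<lambda>i j. disjnt (cball (fst i) (snd i)) (cball (fst j) (snd j))) C"
    and cov: "\<And>i. i \<in> K \<Longrightarrow> \<exists>j. j \<in> C \<and> \<not> disjnt (cball (fst i) (snd i)) (cball (fst j) (snd j)) \<and>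
                        cball (fst i) (snd i) \<subseteq> ball (fst j) (5 * snd j)"
    using Vitali_covering_lemma_cballs_balls[of K snd "max 1 (measure nu UNIV / t)" fst, OF bound] by blast
  \<comment> \<open>The selected family may be finite. It is indexed by all naturals, with empty
    sets off \<open>J\<close>, so that both countable subadditivity and countable additivity apply
    directly.\<close>
  define J where "J = to_nat_on C ` C"
  define F where "F k = (if k \<in> J then ball (fst (from_nat_into C k)) (5 * snd (from_nat_into C k)) else {})" for k
  define G where "G k = (if k \<in> J then cball (fst (from_nat_into C k)) (snd (from_nat_into C k)) else {})" for k
  define c where "c = 5 ^ DIM('a) * unit_ball_vol DIM('a) / t"
  have c0: "0 \<le> c" using t by (simp add: c_def)
  have inC: "from_nat_into C k \<in> C \<and> to_nat_on C (from_nat_into C k) = k" if "k \<in> J" for k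
    using that C(1) by (auto simp: J_def)
  have "open (\<Union>k. F k)" by (auto simp: F_def)
  moreover have "{x. \<exists>r>0. t * r ^ DIM('a) < measure nu (cball x r)} \<subseteq> (\<Union>k. F k)"
  proof clarify
    fix x r assume "0 < r" "t * r ^ DIM('a) < measure nu (cball x r)"
    then have "(x, r) \<in> K" by (simp add: K_def)
    from cov[OF this] obtain j where j: "j \<in> C" "cball x r \<subseteq> ball (fst j) (5 * snd j)" by auto
    with \<open>0 < r\<close> have "x \<in> ball (fst j) (5 * snd j)"
      by (meson centre_in_cball in_mono less_imp_le)
    then have "x \<in> F (to_nat_on C j)" using j C(1) by (simp add: F_def J_def)
    then show "x \<in> (\<Union>k. F k)" by blast
  qed
  moreover have "emeasure lborel (\<Union>k. F k) \<le> ennreal c * emeasure nu UNIV"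
  proof -
    have FG: "emeasure lborel (F k) \<le> ennreal c * emeasure nu (G k)" for k
    proof (cases "k \<in> J")
      case True
      let ?r = "snd (from_nat_into C k)" and ?x = "fst (from_nat_into C k)"
      have "from_nat_into C k \<in> K" using inC[OF True] C(2) by blast
      then have r: "0 < ?r" "t * ?r ^ DIM('a) < measure nu (cball ?x ?r)"
        by (auto simp: K_def)
      have "emeasure lborel (F k) = ennreal (unit_ball_vol DIM('a) * (5 * ?r) ^ DIM('a))"
        using True r by (simp add: F_def emeasure_ball)
      also have "unit_ball_vol DIM('a) * (5 * ?r) ^ DIM('a) = c * (t * ?r ^ DIM('a))"
        using t by (simp add: c_def power_mult_distrib)
      also have "\<dots> \<le> c * measure nu (cball ?x ?r)"
        using r t by (intro mult_left_mono) (auto simp: c_def)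
      also have "ennreal \<dots> = ennreal c * emeasure nu (G k)"
        using True c0 by (simp add: G_def nu.emeasure_eq_measure ennreal_mult)
      finally show ?thesis by (simp add: ennreal_leI)
    qed (simp add: F_def)
    have "emeasure lborel (\<Union>k. F k) \<le> (\<Sum>k. emeasure lborel (F k))"
      by (rule emeasure_subadditive_countably) (auto simp: F_def)
    also have "\<dots> \<le> (\<Sum>k. ennreal c * emeasure nu (G k))"
      using FG by (intro suminf_le) auto
    also have "\<dots> = ennreal c * (\<Sum>k. emeasure nu (G k))"
      by simp
    also have "(\<Sum>k. emeasure nu (G k)) = emeasure nu (\<Union>k. G k)"
    proof (rule suminf_emeasure)
      show "disjoint_family G"
        unfolding disjoint_family_on_def
      proof safe
        fix k l x assume "k \<noteq> l" "x \<in> G k" "x \<in> G l"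
        then have kl: "k \<in> J" "l \<in> J" by (auto simp: G_def split: if_splits)
        then have "from_nat_into C k \<noteq> from_nat_into C l" using inC \<open>k \<noteq> l\<close> by metis
        with disj inC[OF kl(1)] inC[OF kl(2)] have "disjnt (G k) (G l)"
          using kl by (simp add: pairwise_def G_def)
        with \<open>x \<in> G k\<close> \<open>x \<in> G l\<close> show "x \<in> {}" by (auto simp: disjnt_iff)
      qed
    qed (auto simp: G_def nu)
    also have "\<dots> \<le> emeasure nu UNIV"
      by (rule emeasure_mono) (auto simp: nu)
    finally show ?thesis by (simp add: mult_left_mono)
  qed
  ultimately show ?thesis using that unfolding c_def by blast
qed

section \<open>Dyadic decomposition of integrals against a power of the norm\<close>

text \<open>Annuli of radii in geometric progression turn growth of \<open>u\<close> on balls into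
  integrability against a power of the norm.\<close>

lemma nn_integral_annuli:
  fixes u :: "'a::euclidean_space \<Rightarrow> ennreal"
  assumes [measurable]: "u \<in> borel_measurable borel" and D: "D \<in> sets borel"
    and K: "0 \<le> K" and r: "0 < r" and q: "0 < q" "q powr (\<beta> - \<gamma>) < 1" and \<gamma>: "0 \<le> \<gamma>"
    and cover: "\<And>h. h \<in> D \<Longrightarrow> h \<noteq> 0 \<Longrightarrow> \<exists>k::nat. r * q ^ k \<le> norm h \<and> norm h < 2 * (r * q ^ k)"
    and u: "\<And>\<rho>. 0 < \<rho> \<Longrightarrow> (\<integral>\<^sup>+h. u h * indicator (ball 0 \<rho>) h \<partial>lborel) \<le> ennreal (K * \<rho> powr \<beta>)"
  shows "(\<integral>\<^sup>+h. u h * ennreal (1 / norm h powr \<gamma>) * indicator D h \<partial>lborel)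
      \<le> ennreal (K * 2 powr \<beta> * r powr (\<beta> - \<gamma>) / (1 - q powr (\<beta> - \<gamma>)))"
proof -
  \<comment> \<open>The hypothesis on \<open>q\<close> covers two regimes: shrinking radii, q = 1/2,
    when \<beta> > \<gamma>, and growing radii, q = 2, when \<beta> < \<gamma>. In both cases the
    annuli contribute a geometric series of ratio
    \<open>q powr (\<beta> - \<gamma>)\<close>.\<close>
  define a where "a k = r * q ^ k" for k
  have a: "0 < a k" for k using r q by (simp add: a_def)
  note [measurable] = D
  have "(\<integral>\<^sup>+h. u h * ennreal (1 / norm h powr \<gamma>) * indicator D h \<partial>lborel)
      \<le> (\<integral>\<^sup>+h. (\<Sum>k. ennreal (1 / a k powr \<gamma>) * (u h * indicator (ball 0 (2 * a k)) h)) \<partial>lborel)"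
  proof (rule nn_integral_mono)
    fix h :: 'a
    show "u h * ennreal (1 / norm h powr \<gamma>) * indicator D h
        \<le> (\<Sum>k. ennreal (1 / a k powr \<gamma>) * (u h * indicator (ball 0 (2 * a k)) h))"
    proof (cases "h \<in> D \<and> h \<noteq> 0")
      case True
      then obtain k where k: "a k \<le> norm h" "norm h < 2 * a k"
        using cover[of h] by (auto simp: a_def)
      have "ennreal (1 / norm h powr \<gamma>) \<le> ennreal (1 / a k powr \<gamma>)"
        using k a[of k] \<gamma> by (intro ennreal_leI divide_left_mono powr_mono2 mult_pos_pos) auto
      then have "u h * ennreal (1 / norm h powr \<gamma>) \<le> u h * ennreal (1 / a k powr \<gamma>)"
        by (rule mult_left_mono) simp
      then have "u h * ennreal (1 / norm h powr \<gamma>) * indicator D h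
          \<le> ennreal (1 / a k powr \<gamma>) * (u h * indicator (ball 0 (2 * a k)) h)"
        using True k by (simp add: mult.commute)
      \<comment> \<open>The single term belonging to the annulus of \<open>h\<close> already
        dominates the integrand.\<close>
      also have "\<dots> = (\<Sum>k\<in>{k}. ennreal (1 / a k powr \<gamma>) * (u h * indicator (ball 0 (2 * a k)) h))"
        by simp
      also have "\<dots> \<le> (\<Sum>k. ennreal (1 / a k powr \<gamma>) * (u h * indicator (ball 0 (2 * a k)) h))"
        by (rule sum_le_suminf) auto
      finally show ?thesis .
    qed auto
  qed
  also have "\<dots> = (\<Sum>k. ennreal (1 / a k powr \<gamma>) * (\<integral>\<^sup>+h. u h * indicator (ball 0 (2 * a k)) h \<partial>lborel))"
  proof -
    have "(\<integral>\<^sup>+h. (\<Sum>k. ennreal (1 / a k powr \<gamma>) * (u h * indicator (ball 0 (2 * a k)) h)) \<partial>lborel)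
        = (\<Sum>k. \<integral>\<^sup>+h. ennreal (1 / a k powr \<gamma>) * (u h * indicator (ball 0 (2 * a k)) h) \<partial>lborel)"
      by (rule nn_integral_suminf) measurable
    also have "\<dots> = (\<Sum>k. ennreal (1 / a k powr \<gamma>) * (\<integral>\<^sup>+h. u h * indicator (ball 0 (2 * a k)) h \<partial>lborel))"
      by (intro suminf_cong nn_integral_cmult) measurable
    finally show ?thesis .
  qed
  also have "\<dots> \<le> (\<Sum>k. ennreal (K * 2 powr \<beta> * r powr (\<beta> - \<gamma>) * (q powr (\<beta> - \<gamma>)) ^ k))"
  proof (rule suminf_le)
    fix k
    have "ennreal (1 / a k powr \<gamma>) * (\<integral>\<^sup>+h. u h * indicator (ball 0 (2 * a k)) h \<partial>lborel)
        \<le> ennreal (1 / a k powr \<gamma>) * ennreal (K * (2 * a k) powr \<beta>)"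
      using a by (intro mult_left_mono u) auto
    also have "\<dots> = ennreal (1 / a k powr \<gamma> * (K * (2 * a k) powr \<beta>))"
      using K by (intro ennreal_mult[symmetric]) auto
    also have "1 / a k powr \<gamma> * (K * (2 * a k) powr \<beta>) = K * 2 powr \<beta> * a k powr (\<beta> - \<gamma>)"
      using a[of k] by (simp add: powr_mult powr_diff)
    also have "a k powr (\<beta> - \<gamma>) = r powr (\<beta> - \<gamma>) * (q powr (\<beta> - \<gamma>)) ^ k"
      using r q by (simp add: a_def powr_mult powr_realpow[symmetric] powr_powr mult.commute)
    finally show "ennreal (1 / a k powr \<gamma>) * (\<integral>\<^sup>+h. u h * indicator (ball 0 (2 * a k)) h \<partial>lborel)
        \<le> ennreal (K * 2 powr \<beta> * r powr (\<beta> - \<gamma>) * (q powr (\<beta> - \<gamma>)) ^ k)"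
      by (simp add: mult.assoc)
  qed auto
  also have "\<dots> = ennreal (K * 2 powr \<beta> * r powr (\<beta> - \<gamma>) * (1 / (1 - q powr (\<beta> - \<gamma>))))"
    using q K by (intro suminf_ennreal_eq sums_mult geometric_sums) auto
  finally show ?thesis by simp
qed

text \<open>The least k with r / 2^k \<le> x is positive because x < r, and its predecessor is the
  witness. Starting the radii at r / 2 absorbs this shift by one.\<close>

lemma dyadic_inside:
  assumes "0 < x" "x < (r::real)"
  shows "\<exists>k::nat. r / 2 * (1 / 2) ^ k \<le> x \<and> x < 2 * (r / 2 * (1 / 2) ^ k)"
proof -
  have "\<exists>k. r * (1 / 2) ^ k \<le> x"
  proof -
    obtain k where "(1 / 2) ^ k < x / r" using real_arch_pow_inv[of "x / r" "1 / 2"] assms by auto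
    with assms have "r * (1 / 2) ^ k \<le> x" by (simp add: field_simps)
    then show ?thesis ..
  qed
  then obtain k where k: "r * (1 / 2) ^ k \<le> x" "\<And>j. j < k \<Longrightarrow> \<not> r * (1 / 2) ^ j \<le> x"
    using exists_least_iff[of "\<lambda>k. r * (1 / 2) ^ k \<le> x"] by auto
  then obtain j where "k = Suc j" using assms by (cases k) auto
  with k(1) k(2)[of j] show ?thesis by (intro exI[of _ j]) auto
qed

lemma dyadic_outside:
  assumes "0 < r" "r \<le> (x::real)"
  shows "\<exists>k::nat. r * 2 ^ k \<le> x \<and> x < 2 * (r * 2 ^ k)"
proof -
  have "\<exists>k. x < r * 2 ^ k"
  proof -
    obtain k where "x / r < 2 ^ k" using real_arch_pow[of 2 "x / r"] by auto
    with assms have "x < r * 2 ^ k" by (simp add: field_simps)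
    then show ?thesis ..
  qed
  then obtain k where k: "x < r * 2 ^ k" "\<And>j. j < k \<Longrightarrow> \<not> x < r * 2 ^ j"
    using exists_least_iff[of "\<lambda>k. x < r * 2 ^ k"] by auto
  then obtain j where "k = Suc j" using assms by (cases k) auto
  with k(1) k(2)[of j] show ?thesis by (intro exI[of _ j]) auto
qed

section \<open>Mollification\<close>

definition locally_integrable :: "('a::euclidean_space \<Rightarrow> real) \<Rightarrow> bool" where
  "locally_integrable f \<longleftrightarrow> f \<in> borel_measurable borel \<and>
     (\<forall>R. integrable lborel (\<lambda>x. indicator (ball 0 R) x * f x))"

lemma locally_integrable_measurable: "locally_integrable f \<Longrightarrow> f \<in> borel_measurable borel"
  by (simp add: locally_integrable_def)

lemma integrable_times_compact_support:
  fixes f g :: "'a::euclidean_space \<Rightarrow> real"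
  assumes f: "locally_integrable f" and g: "g \<in> borel_measurable borel"
    and bd: "\<And>z. \<bar>g z\<bar> \<le> D * indicator (ball y r) z"
  shows "integrable lborel (\<lambda>z. f z * g z)"
proof -
  have [measurable]: "f \<in> borel_measurable borel" "g \<in> borel_measurable borel"
    using f g by (auto simp: locally_integrable_def)
  have "integrable lborel (\<lambda>z. D * (indicator (ball 0 (norm y + r)) z * f z))"
    using f by (intro integrable_mult_right) (simp add: locally_integrable_def)
  then show ?thesis
  proof (rule Bochner_Integration.integrable_bound)
    have "\<bar>f z * g z\<bar> \<le> \<bar>D * (indicator (ball 0 (norm y + r)) z * f z)\<bar>" for z
    proof (cases "z \<in> ball y r")
      case True
      then have "z \<in> ball 0 (norm y + r)"
        using norm_triangle_ineq[of y "z - y"] by (auto simp: dist_norm norm_minus_commute)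
      with True show ?thesis
        using bd[of z] mult_right_mono[of "\<bar>g z\<bar>" D "\<bar>f z\<bar>"] by (simp add: abs_mult mult.commute)
    next
      case False
      with bd[of z] show ?thesis by simp
    qed
    then show "AE z in lborel. norm (f z * g z) \<le> norm (D * (indicator (ball 0 (norm y + r)) z * f z))"
      by simp
  qed measurable
qed

text \<open>Comes from exp s \<ge> s^2 / 2 at s = 1/t. The gradient bounds derived from it serve to
  establish integrability; the final estimate is controlled by \<open>lam\<close> instead.\<close>

lemma exp_inv_2_le: "exp_inv 2 t \<le> 2"
proof (cases "0 < t")
  case True
  have "(1 / t)\<^sup>2 / 2 \<le> exp (1 / t)"
    using exp_lower_Taylor_quadratic[of "1 / t"] divide_nonneg_pos[of 1 t] True by linarith
  then show ?thesis using True
    by (simp add: exp_inv_def exp_minus field_simps)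
qed (simp add: exp_inv_def)

lemma bump'_abs_le:
  assumes "0 < e" shows "\<bar>bump' e y x\<bar> \<le> 4 / e\<^sup>2 * indicator (ball y e) x"
proof (cases "x \<in> ball y e")
  case True
  have "exp_inv 2 t * 2 / e\<^sup>2 \<le> 4 / e\<^sup>2" for t
    using exp_inv_2_le[of t] assms by (intro divide_right_mono) auto
  then show ?thesis
    using True assms by (simp add: bump'_def abs_mult exp_inv_nonneg)
qed (simp add: bump'_eq_0 assms)

lemma bump_abs_le:
  assumes "0 < e" shows "\<bar>bump e y x\<bar> \<le> 1 * indicator (ball y e) x"
  using bump_le_1[of e y x] bump_nonneg[of e y x] bump_eq_0[OF assms, of x y]
  by (cases "x \<in> ball y e") auto

text \<open>Lets a derivative in the centre of the bump, which arises from moving the point of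
  mollification, be traded for a derivative in the integration variable, which is what the
  distributional gradient sees.\<close>

lemma bump_sym: "bump e x y = bump e y x" "bump' e x y = bump' e y x"
  by (simp_all add: bump_def bump'_def inner_diff_left inner_diff_right inner_commute algebra_simps)

lemma partial_deriv_bump_abs_le:
  assumes "0 < e" "b \<in> Basis"
  shows "\<bar>partial_deriv (bump e y) b x\<bar> \<le> 4 / e * indicator (ball y e) x"
proof (cases "x \<in> ball y e")
  case True
  then have "\<bar>(x - y) \<bullet> b\<bar> \<le> e"
    using Basis_le_norm[OF assms(2), of "x - y"] by (simp add: dist_norm norm_minus_commute)
  then have "\<bar>bump' e y x\<bar> * \<bar>(x - y) \<bullet> b\<bar> \<le> 4 / e\<^sup>2 * e"
    using bump'_abs_le[OF assms(1), of y x] True by (intro mult_mono) auto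
  then show ?thesis
    using True assms by (simp add: partial_deriv_bump abs_mult power2_eq_square)
qed (simp add: partial_deriv_bump bump'_eq_0 assms)

definition bump_mass :: "'a::euclidean_space itself \<Rightarrow> real \<Rightarrow> real" where
  "bump_mass _ e = (\<integral>z. bump e (0::'a) z \<partial>lborel)"

lemma integrable_bump:
  fixes y :: "'a::euclidean_space"
  assumes "0 < e" shows "integrable lborel (bump e y)"
proof -
  have "locally_integrable (\<lambda>_::'a. 1)"
    by (auto simp: locally_integrable_def intro!: integrable_real_indicator emeasure_lborel_ball_finite)
  from integrable_times_compact_support[OF this _ bump_abs_le[OF assms]]
  show ?thesis by simp
qed

lemma integral_bump:
  fixes y :: "'a::euclidean_space"
  shows "(\<integral>z. bump e y z \<partial>lborel) = bump_mass TYPE('a) e"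
proof -
  have "bump_mass TYPE('a) e = (\<integral>z. bump e y (y + z) \<partial>lborel)"
    by (simp add: bump_mass_def bump_def)
  also have "\<dots> = (\<integral>z. bump e y z \<partial>distr lborel borel ((+) y))"
    by (subst integral_distr) auto
  finally show ?thesis by (simp add: lborel_distr_plus)
qed

text \<open>On the ball of half the radius the bump is at least exp (-2). What matters is the order
  e^n, with an explicit constant.\<close>

lemma bump_mass_ge:
  assumes "0 < e"
  shows "exp (- 2) * unit_ball_vol DIM('a) * (e / 2) ^ DIM('a) \<le> bump_mass TYPE('a::euclidean_space) e"
proof -
  have "exp (- 2) * measure lborel (cball (0::'a) (e / 2)) = (\<integral>z. exp (- 2) * indicator (cball (0::'a) (e / 2)) z \<partial>lborel)"
    by simp
  also have "\<dots> \<le> (\<integral>z. bump e (0::'a) z \<partial>lborel)"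
  proof (rule integral_mono)
    show "integrable lborel (\<lambda>z. exp (- 2) * indicator (cball (0::'a) (e / 2)) z :: real)"
      by (intro integrable_mult_right integrable_real_indicator)
         (use assms in \<open>auto simp: emeasure_cball\<close>)
    show "exp (- 2) * indicator (cball (0::'a) (e / 2)) z \<le> bump e 0 z" for z
      using bump_ge[OF assms, of z 0] bump_nonneg by (auto split: split_indicator)
  qed (rule integrable_bump[OF assms])
  finally show ?thesis
    using assms by (simp add: content_cball bump_mass_def mult.assoc)
qed

lemma bump_mass_pos: "0 < e \<Longrightarrow> 0 < bump_mass TYPE('a::euclidean_space) e"
  by (rule less_le_trans[OF _ bump_mass_ge]) simp_all

definition mollify :: "real \<Rightarrow> ('a::euclidean_space \<Rightarrow> real) \<Rightarrow> 'a \<Rightarrow> real" where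
  "mollify e f y = (\<integral>z. f z * bump e y z \<partial>lborel) / bump_mass TYPE('a) e"

lemma integrable_times_bump:
  assumes "locally_integrable f" "0 < e" shows "integrable lborel (\<lambda>z. f z * bump e y z)"
  using integrable_times_compact_support[OF assms(1) _ bump_abs_le[OF assms(2)], of y] by simp

lemma integral_bump_difference:
  fixes z x h :: "'a::euclidean_space"
  assumes e: "0 < e"
  shows "(\<integral>t. indicator {0..1::real} t * (bump' e z (x + t *\<^sub>R h) * ((x + t *\<^sub>R h - z) \<bullet> h)) \<partial>lborel)
     = bump e z (x + h) - bump e z x"
proof -
  let ?d = "\<lambda>t. bump' e z (x + t *\<^sub>R h) * ((x + t *\<^sub>R h - z) \<bullet> h)"
  have "integral\<^sup>L lborel (\<lambda>t. indicator {0..1::real} t *\<^sub>R ?d t)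
      = bump e z (x + 1 *\<^sub>R h) - bump e z (x + 0 *\<^sub>R h)"
  proof (rule integral_FTC_atLeastAtMost)
    fix t :: real
    have "((\<lambda>t. x + t *\<^sub>R h) has_derivative (\<lambda>s. s *\<^sub>R h)) (at t within {0..1})"
      by (auto intro!: derivative_eq_intros)
    from has_derivative_compose[OF this has_derivative_bump[of e z "x + t *\<^sub>R h"]]
    show "((\<lambda>t. bump e z (x + t *\<^sub>R h)) has_vector_derivative ?d t) (at t within {0..1})"
      by (simp add: has_vector_derivative_def ac_simps)
  next
    show "continuous_on {0..1} ?d"
      unfolding bump'_def
      by (intro continuous_intros continuous_on_compose2[OF continuous_exp_inv]) (use e in auto)
  qed simp
  then show ?thesis by simp
qed

lemma borel_measurable_emeasure_cball:
  fixes lam :: "'a::euclidean_space measure"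
  assumes lam: "sets lam = sets borel" "finite_measure lam"
  shows "(\<lambda>y. emeasure lam (cball y e)) \<in> borel_measurable borel"
proof -
  interpret finite_measure lam by fact
  note [measurable_cong] = lam(1)
  have "(\<lambda>y. \<integral>\<^sup>+z. indicator {p. dist (fst p) (snd p) \<le> e} (y, z) \<partial>lam) \<in> borel_measurable borel"
    by measurable
  moreover have "(\<integral>\<^sup>+z. indicator {p. dist (fst p) (snd p) \<le> e} (y, z) \<partial>lam) = emeasure lam (cball y e)" for y
  proof -
    have "(\<integral>\<^sup>+z. indicator {p. dist (fst p) (snd p) \<le> e} (y, z) \<partial>lam) = (\<integral>\<^sup>+z. indicator (cball y e) z \<partial>lam)"
      by (intro nn_integral_cong) (auto split: split_indicator)
    then show ?thesis using lam by simp
  qed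
  ultimately show ?thesis by simp
qed

text \<open>The difference of the two bumps is the integral of a directional derivative along the
  segment. After exchanging the integrals, the inner one pairs \<open>f\<close> with the gradient of
  a bump centred at \<open>x + t *\<^sub>R h\<close>, and \<open>grad\<close> bounds it by the
  \<open>lam\<close>-mass of the ball there.\<close>

lemma mollify_difference_bound:
  fixes f :: "'a::euclidean_space \<Rightarrow> real" and lam :: "'a measure"
  assumes f: "locally_integrable f" and e: "0 < e"
    and lam: "sets lam = sets borel" "finite_measure lam"
    and grad: "\<And>y b. b \<in> Basis \<Longrightarrow>
        \<bar>\<integral>z. f z * partial_deriv (bump e y) b z \<partial>lborel\<bar> \<le> measure lam (cball y e)"
  shows "ennreal \<bar>mollify e f (x + h) - mollify e f x\<bar>
     \<le> ennreal (norm h * DIM('a) / bump_mass TYPE('a) e)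
        * (\<integral>\<^sup>+t. indicator {0..1::real} t * emeasure lam (cball (x + t *\<^sub>R h) e) \<partial>lborel)"
proof -
  interpret lam: finite_measure lam by fact
  note [measurable] = locally_integrable_measurable[OF f] borel_measurable_emeasure_cball[OF lam]
  let ?I = "\<integral>\<^sup>+t. indicator {0..1::real} t * emeasure lam (cball (x + t *\<^sub>R h) e) \<partial>lborel"
  define Z where "Z = bump_mass TYPE('a) e"
  have Z: "0 < Z" unfolding Z_def by (rule bump_mass_pos[OF e])
  define d where "d t z = bump' e z (x + t *\<^sub>R h) * ((x + t *\<^sub>R h - z) \<bullet> h)" for t :: real and z
  define F where "F t z = indicator {0..1::real} t * (f z * d t z)" for t :: real and z
  \<comment> \<open>The minus sign reflects that the derivative in the centre is opposite to the
    derivative in \<open>z\<close>.\<close>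
  have d_eq: "d t z = - (\<Sum>b\<in>Basis. (h \<bullet> b) * partial_deriv (bump e (x + t *\<^sub>R h)) b z)" for t z
  proof -
    have "(x + t *\<^sub>R h - z) \<bullet> h = (\<Sum>b\<in>Basis. ((x + t *\<^sub>R h - z) \<bullet> b) * (h \<bullet> b))"
      by (rule euclidean_inner)
    also have "\<dots> = - (\<Sum>b\<in>Basis. (h \<bullet> b) * ((z - (x + t *\<^sub>R h)) \<bullet> b))"
      by (simp add: sum_negf[symmetric] inner_diff_left inner_add_left algebra_simps)
    finally show ?thesis
      unfolding d_def partial_deriv_bump bump_sym(2)[of e z]
      by (simp only: sum_distrib_left mult.left_commute mult_minus_right)
  qed
  have d_le: "\<bar>d t z\<bar> \<le> 4 / e * norm h * indicator (ball (x + t *\<^sub>R h) e) z" for t z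
  proof (cases "z \<in> ball (x + t *\<^sub>R h) e")
    case True
    have "\<bar>(x + t *\<^sub>R h - z) \<bullet> h\<bar> \<le> norm (x + t *\<^sub>R h - z) * norm h"
      by (rule Cauchy_Schwarz_ineq2)
    also have "\<dots> \<le> e * norm h"
      using True by (intro mult_right_mono) (auto simp: dist_norm)
    finally have "\<bar>d t z\<bar> \<le> 4 / e\<^sup>2 * (e * norm h)"
      unfolding d_def abs_mult bump_sym(2)[of e z]
      using bump'_abs_le[OF e, of "x + t *\<^sub>R h" z] True by (intro mult_mono) auto
    then show ?thesis using True e by (simp add: power2_eq_square)
  next
    case False
    then show ?thesis by (simp add: d_def bump_sym(2)[of e z] bump'_eq_0[OF e])
  qed
  have [measurable]: "(\<lambda>(t, z). F t z) \<in> borel_measurable (lborel \<Otimes>\<^sub>M lborel)"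
    unfolding F_def d_def by measurable
  \<comment> \<open>All bumps centred on the segment vanish outside the ball of this radius about 0,
    so a single local integrability statement justifies Fubini for every \<open>t\<close>.\<close>
  define R where "R = norm x + norm h + e"
  have "integrable lborel (\<lambda>z. indicator (ball 0 R) z * f z)"
    using f by (simp add: locally_integrable_def)
  then have "integrable lborel (\<lambda>z. 4 / e * norm h * (indicator (ball 0 R) z * \<bar>f z\<bar>))"
    using integrable_abs[of lborel "\<lambda>z. indicator (ball 0 R) z * f z"]
    by (intro integrable_mult_right) (simp add: abs_mult)
  then have fin: "(\<integral>\<^sup>+z. ennreal (4 / e * norm h * (indicator (ball 0 R) z * \<bar>f z\<bar>)) \<partial>lborel) < \<infinity>"
    using e by (subst nn_integral_eq_integral) auto
  have F_le: "norm (F t z) \<le> indicator {0..1::real} t * (4 / e * norm h * (indicator (ball 0 R) z * \<bar>f z\<bar>))" for t z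
  proof (cases "t \<in> {0..1} \<and> z \<in> ball (x + t *\<^sub>R h) e")
    case True
    have "norm z \<le> norm x + norm (t *\<^sub>R h) + norm (z - (x + t *\<^sub>R h))"
      by (smt (verit) norm_triangle_ineq norm_triangle_sub)
    moreover have "norm (t *\<^sub>R h) \<le> norm h" using True by (simp add: mult_left_le_one_le)
    ultimately have "z \<in> ball 0 R" using True by (simp add: R_def dist_norm norm_minus_commute)
    then show ?thesis
      using True d_le[of t z] mult_right_mono[of "\<bar>d t z\<bar>" "4 / e * norm h" "\<bar>f z\<bar>"]
      by (simp add: F_def abs_mult mult.commute)
  next
    case False
    then show ?thesis using d_le[of t z] e by (auto simp: F_def)
  qed
  have F_le': "ennreal (norm (F t z)) \<le> indicator {0..1::real} t *
      ennreal (4 / e * norm h * (indicator (ball 0 R) z * \<bar>f z\<bar>))" for t z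
    using ennreal_leI[OF F_le[of t z]] by (cases "t \<in> {0..1}") simp_all
  have int: "integrable (lborel \<Otimes>\<^sub>M lborel) (\<lambda>(t, z). F t z)"
  proof (rule integrableI_bounded)
    have "(\<integral>\<^sup>+p. ennreal (norm ((\<lambda>(t, z). F t z) p)) \<partial>(lborel \<Otimes>\<^sub>M lborel))
       = (\<integral>\<^sup>+t. \<integral>\<^sup>+z. ennreal (norm (F t z)) \<partial>lborel \<partial>lborel)"
      by (subst lborel.nn_integral_fst[symmetric]) auto
    also have "\<dots> \<le> (\<integral>\<^sup>+t. \<integral>\<^sup>+z. indicator {0..1::real} t *
        ennreal (4 / e * norm h * (indicator (ball 0 R) z * \<bar>f z\<bar>)) \<partial>lborel \<partial>lborel)"
      by (intro nn_integral_mono F_le')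
    also have "\<dots> = (\<integral>\<^sup>+z. ennreal (4 / e * norm h * (indicator (ball 0 R) z * \<bar>f z\<bar>)) \<partial>lborel)"
      by (simp add: nn_integral_cmult nn_integral_multc)
    finally show "(\<integral>\<^sup>+p. ennreal (norm ((\<lambda>(t, z). F t z) p)) \<partial>(lborel \<Otimes>\<^sub>M lborel)) < \<infinity>"
      using fin by (rule le_less_trans)
  qed measurable
  have "Z * (mollify e f (x + h) - mollify e f x) = (\<integral>z. f z * (bump e (x + h) z - bump e x z) \<partial>lborel)"
    using Z integrable_times_bump[OF f e]
    by (simp add: mollify_def Z_def[symmetric] right_diff_distrib)
  also have "\<dots> = (\<integral>z. (\<integral>t. F t z \<partial>lborel) \<partial>lborel)"
  proof (rule Bochner_Integration.integral_cong[OF refl])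
    fix z
    have "(\<integral>t. F t z \<partial>lborel) = (\<integral>t. f z * (indicator {0..1::real} t * d t z) \<partial>lborel)"
      by (simp add: F_def ac_simps)
    also have "\<dots> = f z * (\<integral>t. indicator {0..1::real} t * d t z \<partial>lborel)"
      by (rule integral_mult_right_zero)
    also have "(\<integral>t. indicator {0..1::real} t * d t z \<partial>lborel) = bump e z (x + h) - bump e z x"
      unfolding d_def by (rule integral_bump_difference[OF e])
    finally show "f z * (bump e (x + h) z - bump e x z) = (\<integral>t. F t z \<partial>lborel)"
      by (simp add: bump_sym(1)[of e z])
  qed
  also have "\<dots> = (\<integral>t. (\<integral>z. F t z \<partial>lborel) \<partial>lborel)"
    by (rule lborel_pair.Fubini_integral[OF int])
  finally have eq: "Z * (mollify e f (x + h) - mollify e f x) = (\<integral>t. (\<integral>z. F t z \<partial>lborel) \<partial>lborel)" .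
  have inner_le: "\<bar>\<integral>z. F t z \<partial>lborel\<bar> \<le> indicator {0..1::real} t * (norm h * DIM('a) * measure lam (cball (x + t *\<^sub>R h) e))" for t
  proof -
    let ?y = "x + t *\<^sub>R h"
    have intb: "integrable lborel (\<lambda>z. f z * partial_deriv (bump e ?y) b z)" if "b \<in> Basis" for b
      using partial_deriv_bump_abs_le[OF e that]
      by (intro integrable_times_compact_support[OF f, where y="?y" and r=e and D="4 / e"])
         (auto simp: partial_deriv_bump)
    have "(\<integral>z. f z * d t z \<partial>lborel) = (\<integral>z. - (\<Sum>b\<in>Basis. (h \<bullet> b) * (f z * partial_deriv (bump e ?y) b z)) \<partial>lborel)"
      by (simp add: d_eq sum_distrib_left ac_simps)
    also have "\<dots> = - (\<Sum>b\<in>Basis. (h \<bullet> b) * (\<integral>z. f z * partial_deriv (bump e ?y) b z \<partial>lborel))"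
      using intb by simp
    finally have "\<bar>\<integral>z. f z * d t z \<partial>lborel\<bar> \<le> (\<Sum>b\<in>Basis. \<bar>(h \<bullet> b) * (\<integral>z. f z * partial_deriv (bump e ?y) b z \<partial>lborel)\<bar>)"
      by simp
    \<comment> \<open>Each coordinate of \<open>h\<close> is at most its norm; the n equal terms
      produce the dimension factor.\<close>
    also have "\<dots> \<le> (\<Sum>b\<in>(Basis::'a set). norm h * measure lam (cball ?y e))"
      using grad Basis_le_norm by (intro sum_mono) (auto simp: abs_mult intro!: mult_mono)
    finally show ?thesis
      by (auto simp: F_def ac_simps split: split_indicator)
  qed
  have inner_le': "ennreal \<bar>\<integral>z. F t z \<partial>lborel\<bar>
      \<le> ennreal (norm h * DIM('a)) * (indicator {0..1::real} t * emeasure lam (cball (x + t *\<^sub>R h) e))" for t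
    using ennreal_leI[OF inner_le[of t]]
    by (cases "t \<in> {0..1}") (simp_all add: ennreal_mult lam.emeasure_eq_measure)
  have "integrable lborel (\<lambda>t. \<integral>z. F t z \<partial>lborel)"
    using lborel_pair.integrable_fst[OF int] by simp
  then have "ennreal \<bar>\<integral>t. (\<integral>z. F t z \<partial>lborel) \<partial>lborel\<bar> \<le> (\<integral>\<^sup>+t. ennreal \<bar>\<integral>z. F t z \<partial>lborel\<bar> \<partial>lborel)"
    using integral_norm_bound_ennreal by fastforce
  also have "\<dots> \<le> (\<integral>\<^sup>+t. ennreal (norm h * DIM('a)) * (indicator {0..1::real} t * emeasure lam (cball (x + t *\<^sub>R h) e)) \<partial>lborel)"
    by (intro nn_integral_mono inner_le')
  also have "\<dots> = ennreal (norm h * DIM('a)) * ?I"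
    by (rule nn_integral_cmult) measurable
  finally have *: "ennreal (Z * \<bar>mollify e f (x + h) - mollify e f x\<bar>)
      \<le> ennreal (norm h * DIM('a)) * ?I"
    using Z by (simp add: eq[symmetric] abs_mult)
  have "ennreal \<bar>mollify e f (x + h) - mollify e f x\<bar>
      = ennreal (1 / Z) * ennreal (Z * \<bar>mollify e f (x + h) - mollify e f x\<bar>)"
    using Z by (subst ennreal_mult[symmetric]) auto
  also have "\<dots> \<le> ennreal (1 / Z) * (ennreal (norm h * DIM('a)) * ?I)"
    using * by (intro mult_left_mono) auto
  also have "\<dots> = ennreal (norm h * DIM('a) / Z) * ?I"
    using Z by (simp add: mult.assoc[symmetric] ennreal_mult[symmetric] del: ennreal_mult)
  finally show ?thesis by (simp add: Z_def)
qed

text \<open>For \<open>s \<rho> \<le> e\<close> every ball involved lies in \<open>cball x (2 * e)\<close>; otherwise the integrals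
  are exchanged and all the mass involved lies in \<open>cball x (2 * s * \<rho>)\<close>.\<close>

lemma nn_integral_ball_emeasure_cball:
  fixes lam :: "'a::euclidean_space measure"
  assumes lam: "sets lam = sets borel" "finite_measure lam"
    and B: "\<And>r. 0 < r \<Longrightarrow> measure lam (cball x r) \<le> B * r ^ DIM('a)"
    and e: "0 < e" and \<rho>: "0 < \<rho>" and s: "0 \<le> s"
  shows "(\<integral>\<^sup>+h. indicator (ball 0 \<rho>) h * emeasure lam (cball (x + s *\<^sub>R h) e) \<partial>lborel)
     \<le> ennreal (unit_ball_vol DIM('a) * 2 ^ DIM('a) * B * \<rho> ^ DIM('a) * e ^ DIM('a))"
proof -
  interpret lam: finite_measure lam by fact
  note [measurable_cong] = lam(1)
  let ?\<omega> = "unit_ball_vol (real DIM('a))"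
  have B0: "0 \<le> B" using B[of 1] by (simp add: order_trans[OF measure_nonneg])
  show ?thesis
  proof (cases "s * \<rho> \<le> e")
    case True
    have *: "emeasure lam (cball (x + s *\<^sub>R h) e) \<le> ennreal (B * (2 * e) ^ DIM('a))" if "h \<in> ball 0 \<rho>" for h
    proof -
      have "norm (s *\<^sub>R h) \<le> e"
        using that True s mult_left_mono[of "norm h" \<rho> s] by simp
      then have "cball (x + s *\<^sub>R h) e \<subseteq> cball x (2 * e)"
        by (auto intro!: subset_cball simp: cball_subset_cball_iff dist_norm)
      then have "emeasure lam (cball (x + s *\<^sub>R h) e) \<le> emeasure lam (cball x (2 * e))"
        by (intro emeasure_mono) (auto simp: lam)
      also have "\<dots> \<le> ennreal (B * (2 * e) ^ DIM('a))"
        using B[of "2 * e"] e by (simp add: lam.emeasure_eq_measure ennreal_leI)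
      finally show ?thesis .
    qed
    have "(\<integral>\<^sup>+h. indicator (ball 0 \<rho>) h * emeasure lam (cball (x + s *\<^sub>R h) e) \<partial>lborel)
        \<le> (\<integral>\<^sup>+h. ennreal (B * (2 * e) ^ DIM('a)) * indicator (ball (0::'a) \<rho>) h \<partial>lborel)"
      using * by (intro nn_integral_mono) (auto split: split_indicator)
    also have "\<dots> = ennreal (B * (2 * e) ^ DIM('a)) * ennreal (?\<omega> * \<rho> ^ DIM('a))"
      using \<rho> by (simp add: nn_integral_cmult_indicator emeasure_ball)
    also have "\<dots> = ennreal (B * (2 * e) ^ DIM('a) * (?\<omega> * \<rho> ^ DIM('a)))"
      using B0 e \<rho> by (intro ennreal_mult[symmetric]) auto
    finally show ?thesis by (simp add: power_mult_distrib ac_simps)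
  next
    case False
    then have s0: "0 < s" using s e by (cases "s = 0") auto
    interpret pair_sigma_finite lborel lam
      by (intro pair_sigma_finite.intro) (unfold_locales)
    let ?S = "{(h, z). norm h < \<rho> \<and> dist (x + s *\<^sub>R h) z \<le> e}"
    have "(\<integral>\<^sup>+h. indicator (ball 0 \<rho>) h * emeasure lam (cball (x + s *\<^sub>R h) e) \<partial>lborel)
        = (\<integral>\<^sup>+h. (\<integral>\<^sup>+z. indicator ?S (h, z) \<partial>lam) \<partial>lborel)"
    proof (rule nn_integral_cong)
      fix h
      have "(\<integral>\<^sup>+z. indicator ?S (h, z) \<partial>lam) = (\<integral>\<^sup>+z. indicator (ball 0 \<rho>) h * indicator (cball (x + s *\<^sub>R h) e) z \<partial>lam)"
        by (intro nn_integral_cong) (auto split: split_indicator)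
      also have "\<dots> = indicator (ball 0 \<rho>) h * emeasure lam (cball (x + s *\<^sub>R h) e)"
        by (rule nn_integral_cmult_indicator) (simp add: lam)
      finally show "indicator (ball 0 \<rho>) h * emeasure lam (cball (x + s *\<^sub>R h) e) = (\<integral>\<^sup>+z. indicator ?S (h, z) \<partial>lam)" by simp
    qed
    also have "\<dots> = (\<integral>\<^sup>+z. (\<integral>\<^sup>+h. indicator ?S (h, z) \<partial>lborel) \<partial>lam)"
      by (rule Fubini'[symmetric]) measurable
    also have "\<dots> \<le> (\<integral>\<^sup>+z. ennreal (?\<omega> * (e / s) ^ DIM('a)) * indicator (cball x (2 * (s * \<rho>))) z \<partial>lam)"
    proof (rule nn_integral_mono)
      fix z
      show "(\<integral>\<^sup>+h. indicator ?S (h, z) \<partial>lborel)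
          \<le> ennreal (?\<omega> * (e / s) ^ DIM('a)) * indicator (cball x (2 * (s * \<rho>))) z"
      proof (cases "z \<in> cball x (2 * (s * \<rho>))")
        case True
        \<comment> \<open>For fixed \<open>z\<close> the admissible \<open>h\<close> form part of a
          ball of radius e / s, by solving \<open>x + s *\<^sub>R h\<close> for
          \<open>h\<close>.\<close>
        have "(\<integral>\<^sup>+h. indicator ?S (h, z) \<partial>lborel) \<le> (\<integral>\<^sup>+h. indicator (cball ((1 / s) *\<^sub>R (z - x)) (e / s)) h \<partial>lborel)"
        proof (intro nn_integral_mono)
          fix h :: 'a
          have "h \<in> cball ((1 / s) *\<^sub>R (z - x)) (e / s)" if "dist (x + s *\<^sub>R h) z \<le> e"
          proof -
            have "h - (1 / s) *\<^sub>R (z - x) = (1 / s) *\<^sub>R (x + s *\<^sub>R h - z)"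
              using s0 by (simp add: algebra_simps)
            then have "norm (h - (1 / s) *\<^sub>R (z - x)) = norm (x + s *\<^sub>R h - z) / s"
              using s0 by simp
            with that s0 show ?thesis
              by (simp add: dist_norm norm_minus_commute divide_right_mono)
          qed
          then show "indicator ?S (h, z) \<le> (indicator (cball ((1 / s) *\<^sub>R (z - x)) (e / s)) h :: ennreal)"
            by (auto split: split_indicator)
        qed
        also have "\<dots> = ennreal (?\<omega> * (e / s) ^ DIM('a))"
          using e s0 by (simp add: emeasure_cball)
        finally show ?thesis using True by simp
      next
        case z: False
        have "(h, z) \<notin> ?S" for h
        proof
          assume "(h, z) \<in> ?S"
          then have h: "norm h < \<rho>" "dist (x + s *\<^sub>R h) z \<le> e" by auto
          have "dist x z \<le> dist x (x + s *\<^sub>R h) + dist (x + s *\<^sub>R h) z" by (rule dist_triangle)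
          also have "dist x (x + s *\<^sub>R h) = s * norm h" using s0 by (simp add: dist_norm)
          also have "s * norm h \<le> s * \<rho>" using h s0 by simp
          finally show False using h z False by simp
        qed
        then have "(\<integral>\<^sup>+h. indicator ?S (h, z) \<partial>lborel) = 0" by simp
        then show ?thesis by simp
      qed
    qed
    also have "\<dots> = ennreal (?\<omega> * (e / s) ^ DIM('a)) * emeasure lam (cball x (2 * (s * \<rho>)))"
      by (rule nn_integral_cmult_indicator) (simp add: lam)
    also have "\<dots> \<le> ennreal (?\<omega> * (e / s) ^ DIM('a)) * ennreal (B * (2 * (s * \<rho>)) ^ DIM('a))"
      using B[of "2 * (s * \<rho>)"] s0 \<rho> by (intro mult_left_mono) (auto simp: lam.emeasure_eq_measure intro!: ennreal_leI)
    also have "\<dots> = ennreal (?\<omega> * (e / s) ^ DIM('a) * (B * (2 * (s * \<rho>)) ^ DIM('a)))"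
      using B0 e s0 \<rho> by (intro ennreal_mult[symmetric]) auto
    \<comment> \<open>The powers of \<open>s\<close> cancel, so the bound is uniform along the
      segment.\<close>
    also have "?\<omega> * (e / s) ^ DIM('a) * (B * (2 * (s * \<rho>)) ^ DIM('a)) = ?\<omega> * 2 ^ DIM('a) * B * \<rho> ^ DIM('a) * e ^ DIM('a)"
      using s0 by (simp add: power_mult_distrib power_divide)
    finally show ?thesis .
  qed
qed

text \<open>The segment parameter is moved outside, so that for each \<open>t\<close> the average of
  \<open>lam\<close> over balls of radius e is bounded by the preceding lemma. Dividing by the mass
  of the bump removes e^n, and the factor \<open>norm h\<close> supplies the extra power of
  \<rho>.\<close>

lemma nn_integral_mollify_difference:
  fixes f :: "'a::euclidean_space \<Rightarrow> real" and lam :: "'a measure"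
  assumes f: "locally_integrable f" and e: "0 < e"
    and lam: "sets lam = sets borel" "finite_measure lam"
    and grad: "\<And>y b. b \<in> Basis \<Longrightarrow>
        \<bar>\<integral>z. f z * partial_deriv (bump e y) b z \<partial>lborel\<bar> \<le> measure lam (cball y e)"
    and B: "\<And>r. 0 < r \<Longrightarrow> measure lam (cball x r) \<le> B * r ^ DIM('a)" and \<rho>: "0 < \<rho>"
  shows "(\<integral>\<^sup>+h. indicator (ball 0 \<rho>) h * ennreal \<bar>mollify e f (x + h) - mollify e f x\<bar> \<partial>lborel)
     \<le> ennreal (real DIM('a) * exp 2 * 4 ^ DIM('a) * B * \<rho> ^ (DIM('a) + 1))"
proof -
  interpret lam: finite_measure lam by fact
  note [measurable] = borel_measurable_emeasure_cball[OF lam]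
  let ?\<omega> = "unit_ball_vol (real DIM('a))" and ?Z = "bump_mass TYPE('a) e"
  have B0: "0 \<le> B" using B[of 1] by (simp add: order_trans[OF measure_nonneg])
  have Z: "0 < ?Z" by (rule bump_mass_pos[OF e])
  let ?k = "\<lambda>t h. indicator {0..1::real} t * (indicator (ball 0 \<rho>) h * emeasure lam (cball (x + t *\<^sub>R h) e))"
  let ?c = "\<rho> * real DIM('a) / ?Z"
  have pointwise: "indicator (ball 0 \<rho>) h * ennreal \<bar>mollify e f (x + h) - mollify e f x\<bar>
      \<le> ennreal ?c * (\<integral>\<^sup>+t. ?k t h \<partial>lborel)" for h
  proof (cases "h \<in> ball 0 \<rho>")
    case True
    have "ennreal \<bar>mollify e f (x + h) - mollify e f x\<bar>
     \<le> ennreal (norm h * DIM('a) / ?Z)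
        * (\<integral>\<^sup>+t. indicator {0..1::real} t * emeasure lam (cball (x + t *\<^sub>R h) e) \<partial>lborel)"
      by (rule mollify_difference_bound[OF f e lam grad])
    also have "\<dots> \<le> ennreal ?c * (\<integral>\<^sup>+t. indicator {0..1::real} t * emeasure lam (cball (x + t *\<^sub>R h) e) \<partial>lborel)"
      using True Z by (intro mult_right_mono ennreal_leI divide_right_mono) auto
    finally show ?thesis using True by simp
  qed simp
  have "(\<integral>\<^sup>+h. indicator (ball 0 \<rho>) h * ennreal \<bar>mollify e f (x + h) - mollify e f x\<bar> \<partial>lborel)
      \<le> (\<integral>\<^sup>+h. ennreal ?c * (\<integral>\<^sup>+t. ?k t h \<partial>lborel) \<partial>lborel)"
    by (intro nn_integral_mono pointwise)
  also have "\<dots> = ennreal ?c * (\<integral>\<^sup>+h. (\<integral>\<^sup>+t. ?k t h \<partial>lborel) \<partial>lborel)"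
    by (rule nn_integral_cmult) measurable
  also have "(\<integral>\<^sup>+h. (\<integral>\<^sup>+t. ?k t h \<partial>lborel) \<partial>lborel) = (\<integral>\<^sup>+t. (\<integral>\<^sup>+h. ?k t h \<partial>lborel) \<partial>lborel)"
    by (rule lborel_pair.Fubini') measurable
  also have "\<dots> \<le> (\<integral>\<^sup>+t. ennreal (?\<omega> * 2 ^ DIM('a) * B * \<rho> ^ DIM('a) * e ^ DIM('a)) * indicator {0..1::real} t \<partial>lborel)"
  proof (rule nn_integral_mono)
    fix t :: real
    show "(\<integral>\<^sup>+h. ?k t h \<partial>lborel) \<le> ennreal (?\<omega> * 2 ^ DIM('a) * B * \<rho> ^ DIM('a) * e ^ DIM('a)) * indicator {0..1::real} t"
      using nn_integral_ball_emeasure_cball[OF lam B e \<rho>, of t] by (cases "t \<in> {0..1}") auto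
  qed
  also have "\<dots> = ennreal (?\<omega> * 2 ^ DIM('a) * B * \<rho> ^ DIM('a) * e ^ DIM('a))"
    by (subst nn_integral_cmult_indicator) auto
  finally have "(\<integral>\<^sup>+h. indicator (ball 0 \<rho>) h * ennreal \<bar>mollify e f (x + h) - mollify e f x\<bar> \<partial>lborel)
      \<le> ennreal ?c * ennreal (?\<omega> * 2 ^ DIM('a) * B * \<rho> ^ DIM('a) * e ^ DIM('a))"
    by (simp add: mult_left_mono)
  also have "\<dots> = ennreal (?c * (?\<omega> * 2 ^ DIM('a) * B * \<rho> ^ DIM('a) * e ^ DIM('a)))"
    using \<rho> Z B0 e by (intro ennreal_mult[symmetric]) auto
  also have "\<dots> \<le> ennreal (real DIM('a) * exp 2 * 4 ^ DIM('a) * B * \<rho> ^ (DIM('a) + 1))"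
  proof (rule ennreal_leI)
    \<comment> \<open>Source of the constant: \<open>exp 2\<close> and one factor 2^n come from the
      lower bound for the bump on the half ball, the other 2^n from doubling a radius in the average
      of \<open>lam\<close>.\<close>
    let ?W = "exp (- 2) * ?\<omega> * (e / 2) ^ DIM('a)"
    have W: "?W \<le> ?Z" "0 < ?W" using bump_mass_ge[OF e, where 'a='a] e by auto
    have "?c * (?\<omega> * 2 ^ DIM('a) * B * \<rho> ^ DIM('a) * e ^ DIM('a))
      \<le> \<rho> * real DIM('a) / ?W * (?\<omega> * 2 ^ DIM('a) * B * \<rho> ^ DIM('a) * e ^ DIM('a))"
      using W B0 e \<rho> Z by (intro mult_right_mono divide_left_mono) auto
    also have "\<dots> = real DIM('a) * exp 2 * (2 ^ DIM('a) * 2 ^ DIM('a)) * B * \<rho> ^ (DIM('a) + 1)"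
      using e unit_ball_vol_pos[of "real DIM('a)"]
      by (simp add: power_divide exp_minus field_simps del: unit_ball_vol_pos)
    also have "2 ^ DIM('a) * 2 ^ DIM('a) = (4::real) ^ DIM('a)"
      by (simp flip: power_mult_distrib)
    finally show "?c * (?\<omega> * 2 ^ DIM('a) * B * \<rho> ^ DIM('a) * e ^ DIM('a))
      \<le> real DIM('a) * exp 2 * 4 ^ DIM('a) * B * \<rho> ^ (DIM('a) + 1)" .
  qed
  finally show ?thesis .
qed

section \<open>Almost everywhere convergence of mollifications\<close>

definition L1_ball :: "real \<Rightarrow> ('a::euclidean_space \<Rightarrow> real) \<Rightarrow> ennreal" where
  "L1_ball R u = (\<integral>\<^sup>+x. ennreal \<bar>u x\<bar> * indicator (ball 0 R) x \<partial>lborel)"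

lemma L1_ball_triangle:
  assumes [measurable]: "u \<in> borel_measurable borel" "v \<in> borel_measurable borel"
    and le: "\<And>x. \<bar>w x\<bar> \<le> \<bar>u x\<bar> + \<bar>v x\<bar>"
  shows "L1_ball R w \<le> L1_ball R u + L1_ball R v"
proof -
  have "L1_ball R w \<le> (\<integral>\<^sup>+x. ennreal \<bar>u x\<bar> * indicator (ball 0 R) x + ennreal \<bar>v x\<bar> * indicator (ball 0 R) x \<partial>lborel)"
    unfolding L1_ball_def
  proof (rule nn_integral_mono)
    fix x
    show "ennreal \<bar>w x\<bar> * indicator (ball 0 R) x \<le> ennreal \<bar>u x\<bar> * indicator (ball 0 R) x + ennreal \<bar>v x\<bar> * indicator (ball 0 R) x"
      using ennreal_leI[OF le[of x]] by (auto split: split_indicator)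
  qed
  also have "\<dots> = L1_ball R u + L1_ball R v"
    unfolding L1_ball_def by (rule nn_integral_add) measurable
  finally show ?thesis .
qed

lemma locally_integrable_iff:
  "locally_integrable f \<longleftrightarrow> f \<in> borel_measurable borel \<and> (\<forall>R. L1_ball R f < \<infinity>)"
proof -
  have "integrable lborel (\<lambda>x. indicator (ball 0 R) x * f x) \<longleftrightarrow> L1_ball R f < \<infinity>"
    if [measurable]: "f \<in> borel_measurable borel" for R
  proof -
    have "(\<integral>\<^sup>+x. ennreal (norm (indicator (ball 0 R) x * f x)) \<partial>lborel) = L1_ball R f"
      unfolding L1_ball_def by (intro nn_integral_cong) (auto split: split_indicator)
    then show ?thesis by (simp add: integrable_iff_bounded)
  qed
  then show ?thesis by (auto simp: locally_integrable_def)
qed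

lemma locally_integrable_bounded:
  fixes f :: "'a::euclidean_space \<Rightarrow> real"
  assumes "f \<in> borel_measurable borel" "\<And>x. \<bar>f x\<bar> \<le> C"
  shows "locally_integrable f"
proof -
  have "L1_ball R f < \<infinity>" for R
  proof -
    have "L1_ball R f \<le> (\<integral>\<^sup>+x. ennreal C * indicator (ball (0::'a) R) x \<partial>lborel)"
      unfolding L1_ball_def using assms
      by (intro nn_integral_mono) (auto intro!: ennreal_leI split: split_indicator)
    also have "\<dots> < \<infinity>"
      using emeasure_lborel_ball_finite[of "0::'a" R]
      by (simp add: nn_integral_cmult_indicator ennreal_mult_less_top)
    finally show ?thesis .
  qed
  with assms show ?thesis by (simp add: locally_integrable_iff)
qed

lemma locally_integrable_diff:
  assumes "locally_integrable f" "locally_integrable g"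
  shows "locally_integrable (\<lambda>x. f x - g x)"
proof -
  have "L1_ball R (\<lambda>x. f x - g x) < \<infinity>" for R
    by (rule le_less_trans[OF L1_ball_triangle[of f g]])
       (use assms in \<open>auto simp: locally_integrable_iff\<close>)
  with assms show ?thesis by (auto simp: locally_integrable_iff)
qed

lemma borel_measurable_mollify:
  assumes "locally_integrable f" shows "mollify e f \<in> borel_measurable borel"
proof -
  note [measurable] = locally_integrable_measurable[OF assms]
  show ?thesis unfolding mollify_def by measurable
qed

lemma mollify_diff:
  assumes "locally_integrable f" "locally_integrable g" "0 < e"
  shows "mollify e (\<lambda>x. f x - g x) y = mollify e f y - mollify e g y"
  using integrable_times_bump[OF assms(1,3)] integrable_times_bump[OF assms(2,3)]
  by (simp add: mollify_def left_diff_distrib diff_divide_distrib)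

lemma nn_integral_bump:
  fixes y :: "'a::euclidean_space"
  assumes "0 < e" shows "(\<integral>\<^sup>+z. ennreal (bump e y z) \<partial>lborel) = ennreal (bump_mass TYPE('a) e)"
  using integrable_bump[OF assms, of y]
  by (subst nn_integral_eq_integral) (auto simp: bump_nonneg integral_bump)

lemma mollify_abs_le:
  fixes f :: "'a::euclidean_space \<Rightarrow> real"
  assumes "locally_integrable f" "0 < e"
  shows "ennreal \<bar>mollify e f y\<bar> \<le> ennreal (1 / bump_mass TYPE('a) e) * (\<integral>\<^sup>+z. ennreal \<bar>f z\<bar> * ennreal (bump e y z) \<partial>lborel)"
proof -
  let ?Z = "bump_mass TYPE('a) e"
  have Z: "0 < ?Z" by (rule bump_mass_pos[OF assms(2)])
  have "ennreal \<bar>mollify e f y\<bar> = ennreal (1 / ?Z) * ennreal (norm (\<integral>z. f z * bump e y z \<partial>lborel))"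
    using Z by (subst ennreal_mult[symmetric]) (auto simp: mollify_def)
  also have "\<dots> \<le> ennreal (1 / ?Z) * (\<integral>\<^sup>+z. ennreal (norm (f z * bump e y z)) \<partial>lborel)"
    by (intro mult_left_mono integral_norm_bound_ennreal integrable_times_bump[OF assms]) auto
  also have "(\<integral>\<^sup>+z. ennreal (norm (f z * bump e y z)) \<partial>lborel) = (\<integral>\<^sup>+z. ennreal \<bar>f z\<bar> * ennreal (bump e y z) \<partial>lborel)"
    by (intro nn_integral_cong) (simp add: abs_mult ennreal_mult bump_nonneg)
  finally show ?thesis .
qed

text \<open>After Tonelli the normalised bump integrates to 1 in the centre, and only points within
  distance e of the ball can contribute.\<close>

lemma L1_ball_mollify:
  fixes f :: "'a::euclidean_space \<Rightarrow> real"
  assumes f: "locally_integrable f" and e: "0 < e"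
  shows "L1_ball R (mollify e f) \<le> L1_ball (R + e) f"
proof -
  note [measurable] = locally_integrable_measurable[OF f]
  let ?Z = "bump_mass TYPE('a) e"
  have Z: "0 < ?Z" by (rule bump_mass_pos[OF e])
  let ?K = "\<lambda>y z. ennreal \<bar>f z\<bar> * ennreal (bump e y z) * indicator (ball 0 R) y"
  have "L1_ball R (mollify e f) \<le> (\<integral>\<^sup>+y. ennreal (1 / ?Z) * (\<integral>\<^sup>+z. ?K y z \<partial>lborel) \<partial>lborel)"
    unfolding L1_ball_def
  proof (rule nn_integral_mono)
    fix y
    show "ennreal \<bar>mollify e f y\<bar> * indicator (ball 0 R) y \<le> ennreal (1 / ?Z) * (\<integral>\<^sup>+z. ?K y z \<partial>lborel)"
      using mollify_abs_le[OF f e, of y] by (auto split: split_indicator)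
  qed
  also have "\<dots> = ennreal (1 / ?Z) * (\<integral>\<^sup>+y. (\<integral>\<^sup>+z. ?K y z \<partial>lborel) \<partial>lborel)"
    by (rule nn_integral_cmult) measurable
  also have "(\<integral>\<^sup>+y. (\<integral>\<^sup>+z. ?K y z \<partial>lborel) \<partial>lborel) = (\<integral>\<^sup>+z. (\<integral>\<^sup>+y. ?K y z \<partial>lborel) \<partial>lborel)"
    by (rule lborel_pair.Fubini') measurable
  also have "\<dots> \<le> (\<integral>\<^sup>+z. ennreal ?Z * (ennreal \<bar>f z\<bar> * indicator (ball 0 (R + e)) z) \<partial>lborel)"
  proof (rule nn_integral_mono)
    fix z
    have "(\<integral>\<^sup>+y. ?K y z \<partial>lborel) \<le> (\<integral>\<^sup>+y. (ennreal \<bar>f z\<bar> * indicator (ball 0 (R + e)) z) * ennreal (bump e z y) \<partial>lborel)"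
    proof (rule nn_integral_mono)
      fix y
      have "bump e z y = 0" if "y \<in> ball 0 R" "z \<notin> ball 0 (R + e)"
      proof (rule bump_eq_0[OF e], rule)
        assume "y \<in> ball z e"
        then show False using that norm_triangle_ineq[of y "z - y"] by (simp add: dist_norm)
      qed
      then show "?K y z \<le> (ennreal \<bar>f z\<bar> * indicator (ball 0 (R + e)) z) * ennreal (bump e z y)"
        unfolding bump_sym(1)[of e y z] by (auto split: split_indicator)
    qed
    also have "\<dots> = (ennreal \<bar>f z\<bar> * indicator (ball 0 (R + e)) z) * (\<integral>\<^sup>+y. ennreal (bump e z y) \<partial>lborel)"
      by (rule nn_integral_cmult) measurable
    finally show "(\<integral>\<^sup>+y. ?K y z \<partial>lborel) \<le> ennreal ?Z * (ennreal \<bar>f z\<bar> * indicator (ball 0 (R + e)) z)"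
      by (simp add: nn_integral_bump[OF e] mult.commute)
  qed
  also have "\<dots> = ennreal ?Z * L1_ball (R + e) f"
    unfolding L1_ball_def by (rule nn_integral_cmult) measurable
  finally have "L1_ball R (mollify e f) \<le> ennreal (1 / ?Z) * (ennreal ?Z * L1_ball (R + e) f)"
    by (simp add: mult_left_mono)
  also have "\<dots> = L1_ball (R + e) f"
    using Z by (simp add: mult.assoc[symmetric] ennreal_mult[symmetric])
  finally show ?thesis .
qed

text \<open>Averaging reproduces the constant \<open>f y\<close>, so the error is a weighted mean of
  \<open>f z - f y\<close> over the support of the bump.\<close>

lemma mollify_close:
  fixes f :: "'a::euclidean_space \<Rightarrow> real"
  assumes f: "locally_integrable f" and e: "0 < e"
    and close: "\<And>z. z \<in> ball y e \<Longrightarrow> \<bar>f z - f y\<bar> \<le> d" and d: "0 \<le> d"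
  shows "\<bar>mollify e f y - f y\<bar> \<le> d"
proof -
  note [measurable] = locally_integrable_measurable[OF f]
  let ?Z = "bump_mass TYPE('a) e"
  have Z: "0 < ?Z" by (rule bump_mass_pos[OF e])
  have c: "locally_integrable (\<lambda>_::'a. f y)"
    by (rule locally_integrable_bounded[of _ "\<bar>f y\<bar>"]) auto
  have "mollify e (\<lambda>_. f y) y = f y"
    using Z by (simp add: mollify_def integral_bump)
  then have eq: "mollify e f y - f y = mollify e (\<lambda>x. f x - f y) y"
    using mollify_diff[OF f c e] by simp
  have "ennreal \<bar>mollify e f y - f y\<bar> \<le> ennreal (1 / ?Z) * (\<integral>\<^sup>+z. ennreal \<bar>f z - f y\<bar> * ennreal (bump e y z) \<partial>lborel)"
    unfolding eq by (rule mollify_abs_le[OF locally_integrable_diff[OF f c] e])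
  also have "\<dots> \<le> ennreal (1 / ?Z) * (\<integral>\<^sup>+z. ennreal d * ennreal (bump e y z) \<partial>lborel)"
  proof (intro mult_left_mono nn_integral_mono)
    fix z
    show "ennreal \<bar>f z - f y\<bar> * ennreal (bump e y z) \<le> ennreal d * ennreal (bump e y z)"
      using close[of z] bump_eq_0[OF e, of z y]
      by (cases "z \<in> ball y e") (auto intro!: mult_right_mono ennreal_leI)
  qed auto
  also have "\<dots> = ennreal (1 / ?Z) * (ennreal d * ennreal ?Z)"
    by (simp add: nn_integral_cmult nn_integral_bump[OF e])
  also have "\<dots> = ennreal d"
    using Z d by (simp add: ennreal_mult[symmetric])
  finally show ?thesis using d by simp
qed

lemma L1_ball_mollify_continuous:
  fixes g :: "'a::euclidean_space \<Rightarrow> real"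
  assumes cont: "continuous_on UNIV g" and bd: "\<And>x. \<bar>g x\<bar> \<le> C"
  shows "(\<lambda>k. L1_ball R (\<lambda>x. mollify (1 / real (Suc k)) g x - g x)) \<longlonglongrightarrow> 0"
proof -
  have [measurable]: "g \<in> borel_measurable borel"
    using cont borel_measurable_continuous_onI by blast
  have g: "locally_integrable g" by (rule locally_integrable_bounded[OF _ bd]) simp
  note [measurable] = borel_measurable_mollify[OF g]
  have C: "0 \<le> C" using bd[of 0] by simp
  have "(\<lambda>k. \<integral>\<^sup>+x. ennreal \<bar>mollify (1 / real (Suc k)) g x - g x\<bar> * indicator (ball 0 R) x \<partial>lborel)
      \<longlonglongrightarrow> (\<integral>\<^sup>+x. (0::ennreal) \<partial>(lborel :: 'a measure))"
  proof (rule nn_integral_dominated_convergence)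
    show "(\<integral>\<^sup>+x. ennreal (2 * C) * indicator (ball (0::'a) R) x \<partial>lborel) < \<infinity>"
      using emeasure_lborel_ball_finite[of "0::'a" R]
      by (simp add: nn_integral_cmult_indicator ennreal_mult_less_top)
    show "AE x in lborel. ennreal \<bar>mollify (1 / real (Suc k)) g x - g x\<bar> * indicator (ball 0 R) x
        \<le> ennreal (2 * C) * indicator (ball 0 R) x" for k
    proof (rule AE_I2)
      fix x
      have "\<bar>mollify (1 / real (Suc k)) g x - g x\<bar> \<le> 2 * C"
      proof (rule mollify_close[OF g])
        show "\<bar>g z - g x\<bar> \<le> 2 * C" for z using bd[of z] bd[of x] by linarith
      qed (use C in auto)
      then show "ennreal \<bar>mollify (1 / real (Suc k)) g x - g x\<bar> * indicator (ball 0 R) x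
          \<le> ennreal (2 * C) * indicator (ball 0 R) x"
        by (intro mult_right_mono ennreal_leI) auto
    qed
    show "AE x in lborel. (\<lambda>k. ennreal \<bar>mollify (1 / real (Suc k)) g x - g x\<bar> * indicator (ball 0 R) x) \<longlonglongrightarrow> 0"
    proof (rule AE_I2)
      fix x
      have "(\<lambda>k. \<bar>mollify (1 / real (Suc k)) g x - g x\<bar>) \<longlonglongrightarrow> 0"
      proof (rule LIMSEQ_I)
        fix d :: real assume d: "0 < d"
        obtain s where s: "0 < s" "\<And>z. dist z x < s \<Longrightarrow> dist (g z) (g x) < d / 2"
          using cont d unfolding continuous_on_iff by (metis UNIV_I half_gt_zero)
        obtain N where N: "1 / real (Suc N) < s"
          using s(1) nat_approx_posE by metis
        have "norm (\<bar>mollify (1 / real (Suc k)) g x - g x\<bar> - 0) < d" if "N \<le> k" for k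
        proof -
          have k: "1 / real (Suc k) \<le> 1 / real (Suc N)" using that by (simp add: frac_le)
          have "\<bar>mollify (1 / real (Suc k)) g x - g x\<bar> \<le> d / 2"
          proof (rule mollify_close[OF g])
            fix z assume "z \<in> ball x (1 / real (Suc k))"
            then have "dist z x < s" using k N by (simp add: dist_commute)
            from s(2)[OF this] show "\<bar>g z - g x\<bar> \<le> d / 2" by (simp add: dist_real_def)
          qed (use d in auto)
          then show ?thesis using d by simp
        qed
        then show "\<exists>N. \<forall>k\<ge>N. norm (\<bar>mollify (1 / real (Suc k)) g x - g x\<bar> - 0) < d" by blast
      qed
      from tendsto_ennrealI[OF this]
      show "(\<lambda>k. ennreal \<bar>mollify (1 / real (Suc k)) g x - g x\<bar> * indicator (ball 0 R) x) \<longlonglongrightarrow> 0"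
        by (cases "x \<in> ball 0 R") auto
    qed
  qed measurable
  then show ?thesis by (simp add: L1_ball_def)
qed

section \<open>Approximation in L^1 on balls by bounded continuous functions\<close>

definition clip :: "real \<Rightarrow> real \<Rightarrow> real" where "clip c y = max (- c) (min c y)"

lemma clip_abs_le: "0 \<le> c \<Longrightarrow> \<bar>clip c y\<bar> \<le> c"
  by (auto simp: clip_def)

text \<open>Half of the error is spent on truncating \<open>f\<close>, dominated by |f| itself, and
  half on approximating the truncation. Clipping the approximants at the same level keeps them
  continuous and supplies the dominating constant that mere convergence almost everywhere
  lacks.\<close>

lemma L1_ball_dense_continuous:
  fixes f :: "'a::euclidean_space \<Rightarrow> real"
  assumes f: "locally_integrable f" and d: "(0::real) < d"
  obtains g C where "continuous_on UNIV g" "\<And>x. \<bar>g x\<bar> \<le> C" "L1_ball R (\<lambda>x. f x - g x) < ennreal d"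
proof -
  note fm[measurable] = locally_integrable_measurable[OF f]
  have [measurable]: "clip c \<in> borel_measurable borel" for c
    unfolding clip_def[abs_def] by measurable
  have fin: "L1_ball R f < \<infinity>" using f by (simp add: locally_integrable_iff)
  have "(\<lambda>m. \<integral>\<^sup>+x. ennreal \<bar>f x - clip (real m) (f x)\<bar> * indicator (ball 0 R) x \<partial>lborel)
      \<longlonglongrightarrow> (\<integral>\<^sup>+x. (0::ennreal) \<partial>(lborel :: 'a measure))"
  proof (rule nn_integral_dominated_convergence)
    show "(\<integral>\<^sup>+x. ennreal \<bar>f x\<bar> * indicator (ball 0 R) x \<partial>lborel) < \<infinity>"
      using fin by (simp add: L1_ball_def)
    show "AE x in lborel. ennreal \<bar>f x - clip (real m) (f x)\<bar> * indicator (ball 0 R) x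
        \<le> ennreal \<bar>f x\<bar> * indicator (ball 0 R) x" for m
      by (intro AE_I2 mult_right_mono ennreal_leI) (auto simp: clip_def)
    show "AE x in lborel. (\<lambda>m. ennreal \<bar>f x - clip (real m) (f x)\<bar> * indicator (ball 0 R) x) \<longlonglongrightarrow> 0"
    proof (rule AE_I2, rule tendsto_eventually)
      fix x
      obtain N where "\<bar>f x\<bar> \<le> real N" using real_arch_simple by blast
      then have "\<forall>m\<ge>N. ennreal \<bar>f x - clip (real m) (f x)\<bar> * indicator (ball 0 R) x = 0"
        by (auto simp: clip_def)
      then show "\<forall>\<^sub>F m in sequentially. ennreal \<bar>f x - clip (real m) (f x)\<bar> * indicator (ball 0 R) x = 0"
        by (auto simp: eventually_sequentially)
    qed
  qed measurable
  then have "(\<lambda>m. L1_ball R (\<lambda>x. f x - clip (real m) (f x))) \<longlonglongrightarrow> 0"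
    by (simp add: L1_ball_def)
  then have "\<forall>\<^sub>F m in sequentially. L1_ball R (\<lambda>x. f x - clip (real m) (f x)) < ennreal (d / 2)"
    by (rule order_tendstoD) (use d in simp)
  then obtain m where m: "L1_ball R (\<lambda>x. f x - clip (real m) (f x)) < ennreal (d / 2)"
    by (auto simp: eventually_sequentially)
  \<comment> \<open>This notion of measurability is by definition pointwise approximation by
    continuous functions off a negligible set.\<close>
  have "f measurable_on UNIV"
    by (rule lebesgue_measurable_imp_measurable_on) (auto intro!: measurable_completion)
  then obtain N g where N: "negligible N" and g: "\<And>n. continuous_on UNIV (g n)"
    and lim: "\<And>x. x \<notin> N \<Longrightarrow> (\<lambda>n. g n x) \<longlonglongrightarrow> f x"
    unfolding measurable_on_def by auto
  have [measurable]: "g n \<in> borel_measurable borel" for n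
    using g borel_measurable_continuous_onI by blast
  have "N \<in> null_sets lebesgue" using N negligible_iff_null_sets by blast
  then have "AE x in lebesgue. x \<notin> N" by (rule AE_not_in)
  then have AEN: "AE x in lborel. x \<notin> N" by (simp add: AE_completion_iff)
  have "(\<lambda>n. \<integral>\<^sup>+x. ennreal \<bar>clip (real m) (f x) - clip (real m) (g n x)\<bar> * indicator (ball 0 R) x \<partial>lborel)
      \<longlonglongrightarrow> (\<integral>\<^sup>+x. (0::ennreal) \<partial>(lborel :: 'a measure))"
  proof (rule nn_integral_dominated_convergence)
    show "(\<integral>\<^sup>+x. ennreal (2 * real m) * indicator (ball (0::'a) R) x \<partial>lborel) < \<infinity>"
      using emeasure_lborel_ball_finite[of "0::'a" R]
      by (simp add: nn_integral_cmult_indicator ennreal_mult_less_top)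
    show "AE x in lborel. ennreal \<bar>clip (real m) (f x) - clip (real m) (g n x)\<bar> * indicator (ball 0 R) x
        \<le> ennreal (2 * real m) * indicator (ball 0 R) x" for n
      by (intro AE_I2 mult_right_mono ennreal_leI) (auto simp: clip_def)
    show "AE x in lborel. (\<lambda>n. ennreal \<bar>clip (real m) (f x) - clip (real m) (g n x)\<bar> * indicator (ball 0 R) x) \<longlonglongrightarrow> 0"
      using AEN
    proof eventually_elim
      case (elim x)
      have "(\<lambda>n. \<bar>clip (real m) (f x) - clip (real m) (g n x)\<bar>) \<longlonglongrightarrow> \<bar>clip (real m) (f x) - clip (real m) (f x)\<bar>"
        unfolding clip_def by (intro tendsto_intros lim elim)
      then have "(\<lambda>n. \<bar>clip (real m) (f x) - clip (real m) (g n x)\<bar>) \<longlonglongrightarrow> 0" by simp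
      from tendsto_ennrealI[OF this] show ?case
        by (cases "x \<in> ball 0 R") auto
    qed
  qed measurable
  then have "(\<lambda>n. L1_ball R (\<lambda>x. clip (real m) (f x) - clip (real m) (g n x))) \<longlonglongrightarrow> 0"
    by (simp add: L1_ball_def)
  then have "\<forall>\<^sub>F n in sequentially. L1_ball R (\<lambda>x. clip (real m) (f x) - clip (real m) (g n x)) < ennreal (d / 2)"
    by (rule order_tendstoD) (use d in simp)
  then obtain n where n: "L1_ball R (\<lambda>x. clip (real m) (f x) - clip (real m) (g n x)) < ennreal (d / 2)"
    by (auto simp: eventually_sequentially)
  have "L1_ball R (\<lambda>x. f x - clip (real m) (g n x))
      \<le> L1_ball R (\<lambda>x. f x - clip (real m) (f x)) + L1_ball R (\<lambda>x. clip (real m) (f x) - clip (real m) (g n x))"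
    by (rule L1_ball_triangle) auto
  also have "\<dots> < ennreal (d / 2) + ennreal (d / 2)"
    using m n by (rule add_strict_mono)
  also have "\<dots> = ennreal d"
    using d by (simp flip: ennreal_plus)
  finally have "L1_ball R (\<lambda>x. f x - clip (real m) (g n x)) < ennreal d" .
  moreover have "continuous_on UNIV (\<lambda>x. clip (real m) (g n x))"
    unfolding clip_def by (intro continuous_intros g)
  moreover have "\<bar>clip (real m) (g n x)\<bar> \<le> real m" for x by (rule clip_abs_le) simp
  ultimately show ?thesis using that by blast
qed

text \<open>An error split in thirds around a continuous \<open>g\<close>. The approximation is made
  on the ball of radius R + 1, since mollifying at radius at most 1 draws on values up to that
  distance.\<close>

lemma mollify_tendsto_L1_ball:
  fixes f :: "'a::euclidean_space \<Rightarrow> real"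
  assumes f: "locally_integrable f"
  shows "(\<lambda>k. L1_ball R (\<lambda>x. mollify (1 / real (Suc k)) f x - f x)) \<longlonglongrightarrow> 0"
proof (rule order_tendstoI)
  fix a :: ennreal assume "0 < a"
  then obtain d :: real where d: "0 < d" "ennreal d < a"
    by (metis ennreal_less_zero_iff dense ennreal_cases less_top not_less_zero top_greatest less_le_trans linorder_not_le)
  obtain g C where g: "continuous_on UNIV g" "\<And>x. \<bar>g x\<bar> \<le> C"
    and fg: "L1_ball (R + 1) (\<lambda>x. f x - g x) < ennreal (d / 3)"
    using L1_ball_dense_continuous[OF f, of "d / 3" "R + 1"] d by auto
  have gm: "g \<in> borel_measurable borel" using g(1) borel_measurable_continuous_onI by blast
  have gl: "locally_integrable g" by (rule locally_integrable_bounded[OF gm g(2)])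
  note dl = locally_integrable_diff[OF f gl]
  note [measurable] = locally_integrable_measurable[OF f] gm
    borel_measurable_mollify[OF f] borel_measurable_mollify[OF gl] borel_measurable_mollify[OF dl]
  have mono: "L1_ball r (\<lambda>x. f x - g x) < ennreal (d / 3)" if "r \<le> R + 1" for r
  proof (rule le_less_trans[OF _ fg])
    show "L1_ball r (\<lambda>x. f x - g x) \<le> L1_ball (R + 1) (\<lambda>x. f x - g x)"
      unfolding L1_ball_def using that
      by (intro nn_integral_mono mult_left_mono) (auto split: split_indicator)
  qed
  have "\<forall>\<^sub>F k in sequentially. L1_ball R (\<lambda>x. mollify (1 / real (Suc k)) g x - g x) < ennreal (d / 3)"
    by (rule order_tendstoD[OF L1_ball_mollify_continuous[OF g]]) (use d in simp)
  then show "\<forall>\<^sub>F k in sequentially. L1_ball R (\<lambda>x. mollify (1 / real (Suc k)) f x - f x) < a"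
  proof eventually_elim
    case (elim k)
    let ?e = "1 / real (Suc k)"
    have "L1_ball R (\<lambda>x. mollify ?e f x - f x)
       \<le> L1_ball R (mollify ?e (\<lambda>x. f x - g x)) + L1_ball R (\<lambda>x. (mollify ?e g x - g x) - (f x - g x))"
      by (rule L1_ball_triangle) (auto simp: mollify_diff[OF f gl])
    also have "L1_ball R (\<lambda>x. (mollify ?e g x - g x) - (f x - g x))
       \<le> L1_ball R (\<lambda>x. mollify ?e g x - g x) + L1_ball R (\<lambda>x. f x - g x)"
      by (rule L1_ball_triangle) auto
    finally have "L1_ball R (\<lambda>x. mollify ?e f x - f x)
       \<le> L1_ball R (mollify ?e (\<lambda>x. f x - g x)) + (L1_ball R (\<lambda>x. mollify ?e g x - g x) + L1_ball R (\<lambda>x. f x - g x))"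
      by (simp add: add_left_mono)
    also have "\<dots> < ennreal (d / 3) + (ennreal (d / 3) + ennreal (d / 3))"
    proof (intro add_strict_mono)
      have "L1_ball R (mollify ?e (\<lambda>x. f x - g x)) \<le> L1_ball (R + ?e) (\<lambda>x. f x - g x)"
        by (rule L1_ball_mollify[OF dl]) simp
      also have "\<dots> < ennreal (d / 3)" by (rule mono) simp
      finally show "L1_ball R (mollify ?e (\<lambda>x. f x - g x)) < ennreal (d / 3)" .
    qed (use elim mono[of R] in auto)
    also have "\<dots> = ennreal d" using d by (simp flip: ennreal_plus)
    also have "\<dots> < a" by fact
    finally show ?case .
  qed
qed simp

text \<open>L^1 convergence on one ball yields convergence almost everywhere there along a
  subsequence, which may depend on \<open>R\<close>.\<close>

lemma mollify_AE_subseq: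
  fixes f :: "'a::euclidean_space \<Rightarrow> real"
  assumes f: "locally_integrable f"
  obtains r :: "nat \<Rightarrow> nat" where
    "AE x in lborel. x \<in> ball 0 R \<longrightarrow> (\<lambda>k. mollify (1 / real (Suc (r k))) f x) \<longlonglongrightarrow> f x"
proof -
  note [measurable] = locally_integrable_measurable[OF f] borel_measurable_mollify[OF f]
  define u where "u k x = indicator (ball 0 R) x * (mollify (1 / real (Suc k)) f x - f x)" for k x
  have [measurable]: "u k \<in> borel_measurable borel" for k
    unfolding u_def by measurable
  have nn: "(\<integral>\<^sup>+x. ennreal (norm (u k x)) \<partial>lborel) = L1_ball R (\<lambda>x. mollify (1 / real (Suc k)) f x - f x)" for k
    unfolding L1_ball_def u_def by (intro nn_integral_cong) (auto split: split_indicator)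
  have fin: "L1_ball R (\<lambda>x. mollify (1 / real (Suc k)) f x - f x) < \<infinity>" for k
  proof -
    have "L1_ball R (\<lambda>x. mollify (1 / real (Suc k)) f x - f x) \<le> L1_ball R (mollify (1 / real (Suc k)) f) + L1_ball R f"
      by (rule L1_ball_triangle) auto
    also have "\<dots> \<le> L1_ball (R + 1 / real (Suc k)) f + L1_ball R f"
      by (intro add_right_mono L1_ball_mollify[OF f]) simp
    also have "\<dots> < \<infinity>" using f by (simp add: locally_integrable_iff)
    finally show ?thesis .
  qed
  have int: "integrable lborel (u k)" for k
  proof (rule integrableI_bounded)
    show "(\<integral>\<^sup>+x. ennreal (norm (u k x)) \<partial>lborel) < \<infinity>" unfolding nn by (rule fin)
  qed measurable
  have "(\<lambda>k. \<integral>x. norm (u k x) \<partial>lborel) \<longlonglongrightarrow> 0"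
  proof -
    have "(\<integral>x. norm (u k x) \<partial>lborel) = enn2real (L1_ball R (\<lambda>x. mollify (1 / real (Suc k)) f x - f x))" for k
      unfolding nn[symmetric] by (rule integral_eq_nn_integral) auto
    moreover have "(\<lambda>k. enn2real (L1_ball R (\<lambda>x. mollify (1 / real (Suc k)) f x - f x))) \<longlonglongrightarrow> enn2real 0"
      by (rule tendsto_enn2real) (use mollify_tendsto_L1_ball[OF f] in auto)
    ultimately show ?thesis by simp
  qed
  from tendsto_L1_AE_subseq[OF int this] obtain r :: "nat \<Rightarrow> nat"
    where "AE x in lborel. (\<lambda>n. u (r n) x) \<longlonglongrightarrow> 0" by blast
  then have "AE x in lborel. x \<in> ball 0 R \<longrightarrow> (\<lambda>k. mollify (1 / real (Suc (r k))) f x) \<longlonglongrightarrow> f x"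
    by eventually_elim (auto simp: u_def LIM_zero_iff)
  then show ?thesis using that by blast
qed

section \<open>Pointwise bound\<close>

lemma AE_lborel_translate:
  fixes x :: "'a::euclidean_space"
  assumes "AE y in lborel. P y" shows "AE h in lborel. P (x + h)"
proof -
  have "AE y in distr lborel borel ((+) x). P y"
    by (subst lborel_distr_plus) (rule assms)
  then show ?thesis by (rule AE_distrD[rotated]) simp
qed

text \<open>One null set must serve all \<open>B\<close> and \<rho>. It is the union of the
  countably many null sets belonging to integer radii R; everything after that is done at a fixed
  good point.\<close>

lemma AE_oscillation_bound:
  fixes f :: "'a::euclidean_space \<Rightarrow> real" and lam :: "'a measure"
  assumes f: "locally_integrable f"
    and lam: "sets lam = sets borel" "finite_measure lam"
    and grad: "\<And>e y b. 0 < e \<Longrightarrow> b \<in> Basis \<Longrightarrow>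
        \<bar>\<integral>z. f z * partial_deriv (bump e y) b z \<partial>lborel\<bar> \<le> measure lam (cball y e)"
  shows "AE x in lborel. \<forall>B. (\<forall>r>0. measure lam (cball x r) \<le> B * r ^ DIM('a)) \<longrightarrow>
     (\<forall>\<rho>>0. (\<integral>\<^sup>+h. ennreal \<bar>f (x + h) - f x\<bar> * indicator (ball 0 \<rho>) h \<partial>lborel)
        \<le> ennreal (real DIM('a) * exp 2 * 4 ^ DIM('a) * B * \<rho> ^ (DIM('a) + 1)))"
proof -
  note [measurable] = locally_integrable_measurable[OF f] borel_measurable_mollify[OF f]
  have "\<exists>r :: nat \<Rightarrow> nat. AE x in lborel. x \<in> ball 0 (real R) \<longrightarrow> (\<lambda>k. mollify (1 / real (Suc (r k))) f x) \<longlonglongrightarrow> f x" for R :: nat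
    by (rule mollify_AE_subseq[OF f, of "real R"]) (rule exI)
  then have "\<forall>R::nat. \<exists>r :: nat \<Rightarrow> nat. AE x in lborel. x \<in> ball 0 (real R) \<longrightarrow> (\<lambda>k. mollify (1 / real (Suc (r k))) f x) \<longlonglongrightarrow> f x"
    by (rule allI)
  from choice[OF this] obtain r :: "nat \<Rightarrow> nat \<Rightarrow> nat" where
    r: "\<And>R::nat. AE x in lborel. x \<in> ball 0 (real R) \<longrightarrow> (\<lambda>k. mollify (1 / real (Suc (r R k))) f x) \<longlonglongrightarrow> f x"
    by (elim exE) (rule that, erule spec)
  then have "AE x in lborel. \<forall>R::nat. x \<in> ball 0 (real R) \<longrightarrow> (\<lambda>k. mollify (1 / real (Suc (r R k))) f x) \<longlonglongrightarrow> f x"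
    by (simp add: AE_all_countable)
  then show ?thesis
  proof eventually_elim
    case (elim x)
    show ?case
    proof (intro allI impI)
      fix B \<rho> :: real
      assume B: "\<forall>r>0. measure lam (cball x r) \<le> B * r ^ DIM('a)" and \<rho>: "0 < \<rho>"
      \<comment> \<open>Chosen so that \<open>x\<close> and all \<open>x + h\<close> with
        \<open>norm h\<close> below \<rho> lie in one ball, where a single subsequence
        converges.\<close>
      obtain R :: nat where R: "norm x + \<rho> < real R" using reals_Archimedean2 by blast
      let ?m = "\<lambda>k. mollify (1 / real (Suc (r R k))) f"
      let ?v = "\<lambda>k h. indicator (ball 0 \<rho>) h * ennreal \<bar>?m k (x + h) - ?m k x\<bar>"
      have x: "(\<lambda>k. ?m k x) \<longlonglongrightarrow> f x" using elim R \<rho> by simp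
      have "AE h in lborel. ennreal \<bar>f (x + h) - f x\<bar> * indicator (ball 0 \<rho>) h = liminf (\<lambda>k. ?v k h)"
        using AE_lborel_translate[OF r[of R], of x]
      proof eventually_elim
        case (elim h)
        show ?case
        proof (cases "h \<in> ball 0 \<rho>")
          case True
          then have "x + h \<in> ball 0 (real R)"
            using R norm_triangle_ineq[of x h] by simp
          with elim have "(\<lambda>k. ?m k (x + h)) \<longlonglongrightarrow> f (x + h)" by blast
          with x have "(\<lambda>k. \<bar>?m k (x + h) - ?m k x\<bar>) \<longlonglongrightarrow> \<bar>f (x + h) - f x\<bar>"
            by (intro tendsto_intros)
          then have "(\<lambda>k. ennreal \<bar>?m k (x + h) - ?m k x\<bar>) \<longlonglongrightarrow> ennreal \<bar>f (x + h) - f x\<bar>"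
            by (rule tendsto_ennrealI)
          from lim_imp_Liminf[OF sequentially_bot this] show ?thesis using True by simp
        qed (simp add: Liminf_const)
      qed
      then have "(\<integral>\<^sup>+h. ennreal \<bar>f (x + h) - f x\<bar> * indicator (ball 0 \<rho>) h \<partial>lborel) = (\<integral>\<^sup>+h. liminf (\<lambda>k. ?v k h) \<partial>lborel)"
        by (rule nn_integral_cong_AE)
      also have "\<dots> \<le> liminf (\<lambda>k. \<integral>\<^sup>+h. ?v k h \<partial>lborel)"
        by (rule nn_integral_liminf) measurable
      also have "\<dots> \<le> ennreal (real DIM('a) * exp 2 * 4 ^ DIM('a) * B * \<rho> ^ (DIM('a) + 1))"
        unfolding liminf_SUP_INF
      proof (rule SUP_least, rule INF_lower2)
        fix n :: nat
        show "n \<in> {n..}" by simp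
        show "(\<integral>\<^sup>+h. ?v n h \<partial>lborel) \<le> ennreal (real DIM('a) * exp 2 * 4 ^ DIM('a) * B * \<rho> ^ (DIM('a) + 1))"
          by (rule nn_integral_mollify_difference[OF f _ lam grad _ \<rho>]) (use B in auto)
      qed
      finally show "(\<integral>\<^sup>+h. ennreal \<bar>f (x + h) - f x\<bar> * indicator (ball 0 \<rho>) h \<partial>lborel)
        \<le> ennreal (real DIM('a) * exp 2 * 4 ^ DIM('a) * B * \<rho> ^ (DIM('a) + 1))" .
    qed
  qed
qed

text \<open>The kernel exponent n + \<alpha> lies strictly between the two growth exponents: n + 1
  for the oscillation near 0, and n for the size at infinity. The annuli therefore have ratios
  (1/2)^(1-\<alpha>) and 2^(-\<alpha>), whose geometric series give the two denominators.\<close>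

lemma frac_D_pointwise:
  fixes f :: "'a::euclidean_space \<Rightarrow> real"
  assumes \<alpha>: "0 < \<alpha>" "\<alpha> < 1" and [measurable]: "f \<in> borel_measurable borel"
    and A: "0 < A" and B: "0 < B" and K: "0 \<le> K" and L: "0 \<le> L"
    and near: "\<And>\<rho>. 0 < \<rho> \<Longrightarrow> (\<integral>\<^sup>+h. ennreal \<bar>f (x + h) - f x\<bar> * indicator (ball 0 \<rho>) h \<partial>lborel)
        \<le> ennreal (K * B * \<rho> ^ (DIM('a) + 1))"
    and far: "\<And>\<rho>. 0 < \<rho> \<Longrightarrow> (\<integral>\<^sup>+h. ennreal \<bar>f (x + h)\<bar> * indicator (ball 0 \<rho>) h \<partial>lborel)
        \<le> ennreal (L * A * \<rho> ^ DIM('a))"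
    and fx: "\<bar>f x\<bar> \<le> A"
  shows "frac_D \<alpha> f x \<le> ennreal ((K * 2 powr (real DIM('a) + 1) * (1 / 2) powr (1 - \<alpha>) / (1 - (1 / 2) powr (1 - \<alpha>))
      + (L + unit_ball_vol DIM('a)) * 2 powr real DIM('a) / (1 - 2 powr (- \<alpha>))) * A powr (1 - \<alpha>) * B powr \<alpha>)"
proof -
  let ?n = "real DIM('a)" and ?\<omega> = "unit_ball_vol (real DIM('a))"
  define u where "u h = ennreal \<bar>f (x + h) - f x\<bar>" for h
  define r where "r = A / B"
  have r: "0 < r" using A B by (simp add: r_def)
  have [measurable]: "u \<in> borel_measurable borel" unfolding u_def by measurable
  have q1: "(1 / 2) powr (1 - \<alpha>) < (1::real)" using powr_less_mono2[of "1 - \<alpha>" "1 / 2" 1] \<alpha> by simp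
  have q2: "2 powr (- \<alpha>) < (1::real)" using powr_less_mono[of "- \<alpha>" 0 2] \<alpha> by simp
  have near': "(\<integral>\<^sup>+h. u h * indicator (ball 0 \<rho>) h \<partial>lborel) \<le> ennreal (K * B * \<rho> powr (?n + 1))" if "0 < \<rho>" for \<rho>
    using near[OF that] that by (simp add: u_def powr_add powr_realpow mult.commute)
  \<comment> \<open>The value \<open>f x\<close> is charged at \<open>A\<close> over the whole ball,
    which adds the unit ball volume to \<open>L\<close>.\<close>
  have far': "(\<integral>\<^sup>+h. u h * indicator (ball 0 \<rho>) h \<partial>lborel) \<le> ennreal ((L + ?\<omega>) * A * \<rho> powr ?n)" if \<rho>: "0 < \<rho>" for \<rho>
  proof -
    have "(\<integral>\<^sup>+h. u h * indicator (ball 0 \<rho>) h \<partial>lborel)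
       \<le> (\<integral>\<^sup>+h. ennreal \<bar>f (x + h)\<bar> * indicator (ball 0 \<rho>) h + ennreal A * indicator (ball 0 \<rho>) h \<partial>lborel)"
    proof (rule nn_integral_mono)
      fix h
      have "u h \<le> ennreal (\<bar>f (x + h)\<bar> + A)"
        unfolding u_def using fx by (intro ennreal_leI) linarith
      then show "u h * indicator (ball 0 \<rho>) h \<le> ennreal \<bar>f (x + h)\<bar> * indicator (ball 0 \<rho>) h + ennreal A * indicator (ball 0 \<rho>) h"
        using A by (auto split: split_indicator)
    qed
    also have "\<dots> = (\<integral>\<^sup>+h. ennreal \<bar>f (x + h)\<bar> * indicator (ball 0 \<rho>) h \<partial>lborel) + (\<integral>\<^sup>+h. ennreal A * indicator (ball (0::'a) \<rho>) h \<partial>lborel)"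
      by (rule nn_integral_add) measurable
    also have "(\<integral>\<^sup>+h. ennreal A * indicator (ball (0::'a) \<rho>) h \<partial>lborel) = ennreal (A * (?\<omega> * \<rho> ^ DIM('a)))"
      using \<rho> A by (simp add: nn_integral_cmult_indicator emeasure_ball ennreal_mult)
    also have "(\<integral>\<^sup>+h. ennreal \<bar>f (x + h)\<bar> * indicator (ball 0 \<rho>) h \<partial>lborel) + ennreal (A * (?\<omega> * \<rho> ^ DIM('a)))
       \<le> ennreal (L * A * \<rho> ^ DIM('a)) + ennreal (A * (?\<omega> * \<rho> ^ DIM('a)))"
      by (intro add_right_mono far \<rho>)
    also have "\<dots> = ennreal (L * A * \<rho> ^ DIM('a) + A * (?\<omega> * \<rho> ^ DIM('a)))"
      using L A \<rho> by (intro ennreal_plus[symmetric]) auto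
    also have "L * A * \<rho> ^ DIM('a) + A * (?\<omega> * \<rho> ^ DIM('a)) = (L + ?\<omega>) * A * \<rho> powr ?n"
      using \<rho> by (simp add: powr_realpow algebra_simps)
    finally show ?thesis .
  qed
  let ?w = "\<lambda>h. u h * ennreal (1 / norm h powr (?n + \<alpha>))"
  have "frac_D \<alpha> f x = (\<integral>\<^sup>+h. ?w h \<partial>lborel)"
    unfolding frac_D_def nn_integral_completion
    by (intro nn_integral_cong) (simp add: u_def ennreal_mult[symmetric])
  also have "\<dots> = (\<integral>\<^sup>+h. ?w h * indicator (ball 0 r) h + ?w h * indicator (- ball 0 r) h \<partial>lborel)"
    by (intro nn_integral_cong) (auto split: split_indicator)
  also have "\<dots> = (\<integral>\<^sup>+h. ?w h * indicator (ball 0 r) h \<partial>lborel) + (\<integral>\<^sup>+h. ?w h * indicator (- ball 0 r) h \<partial>lborel)"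
    by (rule nn_integral_add) measurable
  \<comment> \<open>The inner family of radii starts at r / 2, hence the factor (1/2)^(1-\<alpha>)
    extracted below.\<close>
  also have "\<dots> \<le> ennreal (K * B * 2 powr (?n + 1) * (r / 2) powr (?n + 1 - (?n + \<alpha>)) / (1 - (1 / 2) powr (?n + 1 - (?n + \<alpha>))))
      + ennreal ((L + ?\<omega>) * A * 2 powr ?n * r powr (?n - (?n + \<alpha>)) / (1 - 2 powr (?n - (?n + \<alpha>))))"
  proof (intro add_mono nn_integral_annuli)
    show "\<exists>k::nat. r / 2 * (1 / 2) ^ k \<le> norm h \<and> norm h < 2 * (r / 2 * (1 / 2) ^ k)" if "h \<in> ball 0 r" "h \<noteq> 0" for h :: 'a
      using dyadic_inside[of "norm h" r] that by simp
    show "\<exists>k::nat. r * 2 ^ k \<le> norm h \<and> norm h < 2 * (r * 2 ^ k)" if "h \<in> - ball 0 r" for h :: 'a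
      using dyadic_outside[of r "norm h"] that r by simp
  qed (use K B A L r \<alpha> q1 q2 near' far' in \<open>auto simp: unit_ball_vol_nonneg\<close>)
  also have "\<dots> = ennreal (K * B * 2 powr (?n + 1) * (r / 2) powr (?n + 1 - (?n + \<alpha>)) / (1 - (1 / 2) powr (?n + 1 - (?n + \<alpha>)))
      + (L + ?\<omega>) * A * 2 powr ?n * r powr (?n - (?n + \<alpha>)) / (1 - 2 powr (?n - (?n + \<alpha>))))"
    using K B A L q1 q2 by (intro ennreal_plus[symmetric]) auto
  also have "K * B * 2 powr (?n + 1) * (r / 2) powr (?n + 1 - (?n + \<alpha>)) / (1 - (1 / 2) powr (?n + 1 - (?n + \<alpha>)))
     = K * 2 powr (?n + 1) * (1 / 2) powr (1 - \<alpha>) / (1 - (1 / 2) powr (1 - \<alpha>)) * (B * r powr (1 - \<alpha>))"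
    using powr_mult[of r "1 / 2" "1 - \<alpha>"] r by simp
  also have "B * r powr (1 - \<alpha>) = A powr (1 - \<alpha>) * B powr \<alpha>"
    using A B by (simp add: r_def powr_divide powr_diff)
  also have "(L + ?\<omega>) * A * 2 powr ?n * r powr (?n - (?n + \<alpha>)) / (1 - 2 powr (?n - (?n + \<alpha>)))
     = (L + ?\<omega>) * 2 powr ?n / (1 - 2 powr (- \<alpha>)) * (A * r powr (- \<alpha>))"
    by simp
  also have "A * r powr (- \<alpha>) = A powr (1 - \<alpha>) * B powr \<alpha>"
    using A B by (simp add: r_def powr_divide powr_diff powr_minus field_simps)
  finally show ?thesis
    by (simp add: distrib_right mult.assoc)
qed

section \<open>Exceptional sets and the weak-type estimate\<close>

text \<open>The reciprocal 1/p with 1/\<infinity> = 0, so that finite and infinite p share the level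
  N m^(-1/p).\<close>

definition inv_exponent :: "ereal \<Rightarrow> real" where
  "inv_exponent p = (if p = \<infinity> then 0 else 1 / real_of_ereal p)"

text \<open>Shows \<open>p_alpha\<close> as the interpolation exponent between p, with weight 1 -
  \<alpha>, and 1, with weight \<alpha>.\<close>

lemma inverse_p_alpha:
  assumes "0 < \<alpha>" "\<alpha> < 1" "1 \<le> p"
  shows "1 / p_alpha \<alpha> p = (1 - \<alpha>) * inv_exponent p + \<alpha>" "0 < 1 / p_alpha \<alpha> p"
proof -
  show *: "1 / p_alpha \<alpha> p = (1 - \<alpha>) * inv_exponent p + \<alpha>"
  proof (cases p)
    case (real q)
    then have "1 \<le> q" using assms by simp
    then have "1 - \<alpha> + \<alpha> * q > 0" using assms by (simp add: add_pos_pos)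
    with real \<open>1 \<le> q\<close> show ?thesis by (simp add: p_alpha_def inv_exponent_def field_simps)
  qed (use assms in \<open>auto simp: p_alpha_def inv_exponent_def\<close>)
  have "0 \<le> inv_exponent p"
    using assms by (cases p) (auto simp: inv_exponent_def)
  then show "0 < 1 / p_alpha \<alpha> p"
    unfolding * using assms by (simp add: add_nonneg_pos)
qed

lemma nn_integral_lborel_translate:
  fixes x :: "'a::euclidean_space"
  assumes [measurable]: "g \<in> borel_measurable borel"
  shows "(\<integral>\<^sup>+h. g (x + h) \<partial>lborel) = (\<integral>\<^sup>+y. g y \<partial>lborel)"
proof -
  have "(\<integral>\<^sup>+y. g y \<partial>lborel) = (\<integral>\<^sup>+y. g y \<partial>distr lborel borel ((+) x))"
    by (simp add: lborel_distr_plus)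
  also have "\<dots> = (\<integral>\<^sup>+h. g (x + h) \<partial>lborel)"
    by (rule nn_integral_distr) auto
  finally show ?thesis ..
qed

section \<open>Exceptional sets for functions in L^p\<close>

lemma abs_le_add_powr:
  fixes y :: real
  assumes "0 < a" "1 \<le> q"
  shows "\<bar>y\<bar> \<le> a + a powr (1 - q) * \<bar>y\<bar> powr q"
proof (cases "\<bar>y\<bar> \<le> a")
  case False
  have "\<bar>y\<bar> = a powr (1 - q) * (a powr (q - 1) * \<bar>y\<bar> powr 1)"
    using assms False by (simp add: mult.assoc[symmetric] powr_add[symmetric])
  also have "\<dots> \<le> a powr (1 - q) * (\<bar>y\<bar> powr (q - 1) * \<bar>y\<bar> powr 1)"
    using assms False by (intro mult_left_mono mult_right_mono powr_mono2) auto
  also have "\<bar>y\<bar> powr (q - 1) * \<bar>y\<bar> powr 1 = \<bar>y\<bar> powr q"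
    by (simp only: powr_add[symmetric]) simp
  finally show ?thesis using assms by simp
qed (auto intro: add_increasing2)

lemma in_Lp_locally_integrable:
  fixes f :: "'a::euclidean_space \<Rightarrow> real"
  assumes [measurable]: "f \<in> borel_measurable borel" and p: "1 \<le> p" and Lp: "in_Lp p f"
  shows "locally_integrable f"
proof -
  have "L1_ball R f < \<infinity>" for R
  proof (cases p)
    case (real q)
    then have q: "1 \<le> q" using p by simp
    have "integrable lebesgue (\<lambda>x. \<bar>f x\<bar> powr q)" using Lp real by (simp add: in_Lp_def)
    then have int: "integrable lborel (\<lambda>x. \<bar>f x\<bar> powr q)" by (subst (asm) integrable_completion) auto
    have "L1_ball R f \<le> (\<integral>\<^sup>+x. indicator (ball 0 R) x + ennreal (\<bar>f x\<bar> powr q) \<partial>lborel)"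
      unfolding L1_ball_def
    proof (rule nn_integral_mono)
      fix x
      have "ennreal \<bar>f x\<bar> \<le> ennreal (1 + \<bar>f x\<bar> powr q)"
        using abs_le_add_powr[of 1 q "f x"] q by (intro ennreal_leI) simp
      then show "ennreal \<bar>f x\<bar> * indicator (ball 0 R) x \<le> indicator (ball 0 R) x + ennreal (\<bar>f x\<bar> powr q)"
        by (auto split: split_indicator)
    qed
    also have "\<dots> = emeasure lborel (ball (0::'a) R) + (\<integral>\<^sup>+x. ennreal (\<bar>f x\<bar> powr q) \<partial>lborel)"
      by (subst nn_integral_add) auto
    also have "\<dots> < \<infinity>"
      using emeasure_lborel_ball_finite[of "0::'a" R] int
      by (subst nn_integral_eq_integral) auto
    finally show ?thesis .
  next
    case PInf
    then obtain C where "AE x in lborel. \<bar>f x\<bar> \<le> C"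
      using Lp by (auto simp: in_Lp_def AE_completion_iff)
    then have "L1_ball R f \<le> (\<integral>\<^sup>+x. ennreal C * indicator (ball (0::'a) R) x \<partial>lborel)"
      unfolding L1_ball_def
      by (intro nn_integral_mono_AE) (erule eventually_mono, auto intro!: ennreal_leI split: split_indicator)
    also have "\<dots> < \<infinity>"
      using emeasure_lborel_ball_finite[of "0::'a" R]
      by (simp add: nn_integral_cmult_indicator ennreal_mult_less_top)
    finally show ?thesis .
  qed (use p in auto)
  then show ?thesis by (simp add: locally_integrable_iff)
qed

text \<open>The real \<open>Inf\<close> in \<open>Lp_norm\<close> has its order properties only on a
  nonempty set.\<close>

lemma essential_bounds_nonempty:
  assumes "in_Lp \<infinity> f"
  shows "{C. 0 \<le> C \<and> (AE x in lebesgue. \<bar>f x\<bar> \<le> C)} \<noteq> {}"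
proof -
  obtain C where "AE x in lebesgue. \<bar>f x\<bar> \<le> C"
    using assms by (auto simp: in_Lp_def)
  then have "AE x in lebesgue. \<bar>f x\<bar> \<le> max 0 C" by eventually_elim auto
  then show ?thesis by (auto intro!: exI[of _ "max 0 C"])
qed

lemma Lp_norm_nonneg:
  assumes "in_Lp p f" shows "0 \<le> Lp_norm p f"
proof (cases "p = \<infinity>")
  case True
  have "0 \<le> Inf {C. 0 \<le> C \<and> (AE x in lebesgue. \<bar>f x\<bar> \<le> C)}"
    using essential_bounds_nonempty assms True by (intro cInf_greatest) auto
  with True show ?thesis by (simp add: Lp_norm_def)
qed (simp add: Lp_norm_def)

text \<open>For finite p the set \<open>W\<close> has two parts: where a ball average of |f|^p is
  too large (weak-type bound), and where |f|^p itself is too large (Markov), which accounts for the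
  added 1. For p = \<infinity> the bounds hold almost everywhere and \<open>W\<close> is
  empty.\<close>

lemma Lp_exceptional_set:
  fixes f :: "'a::euclidean_space \<Rightarrow> real"
  assumes [measurable]: "f \<in> borel_measurable borel" and p: "1 \<le> p" and Lp: "in_Lp p f"
    and N: "Lp_norm p f < N" "0 < N" and m: "0 < m"
  defines "a \<equiv> N * m powr (- inv_exponent p)"
  obtains W where "W \<in> sets borel"
    "emeasure lborel W \<le> ennreal ((5 ^ DIM('a) * unit_ball_vol DIM('a) + 1) * m)"
    "AE x in lborel. x \<notin> W \<longrightarrow> \<bar>f x\<bar> \<le> a \<and>
       (\<forall>\<rho>>0. (\<integral>\<^sup>+h. ennreal \<bar>f (x + h)\<bar> * indicator (ball 0 \<rho>) h \<partial>lborel)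
          \<le> ennreal ((unit_ball_vol DIM('a) + 1) * a * \<rho> ^ DIM('a)))"
proof (cases p)
  case (real q)
  let ?\<omega> = "unit_ball_vol (real DIM('a))"
  have q: "1 \<le> q" using p real by simp
  have a: "a = N * m powr (- (1 / q))" "0 < a" using N m real by (auto simp: a_def inv_exponent_def)
  \<comment> \<open>This is a^q. At this level, and with integral of |f|^q at most N^q, both the
    weak-type and the Markov bound give sets of measure O(m).\<close>
  define s where "s = N powr q / m"
  have s: "0 < s" using N m by (simp add: s_def)
  have aq: "a powr q = s"
    using N m q by (simp add: a(1) s_def powr_mult powr_powr powr_neg_one)
  define I where "I = (\<integral>x. \<bar>f x\<bar> powr q \<partial>lborel)"
  have "integrable lebesgue (\<lambda>x. \<bar>f x\<bar> powr q)" using Lp real by (simp add: in_Lp_def)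
  then have int: "integrable lborel (\<lambda>x. \<bar>f x\<bar> powr q)" by (subst (asm) integrable_completion) auto
  have I0: "0 \<le> I" by (simp add: I_def)
  have "Lp_norm p f = I powr (1 / q)"
    using real by (simp add: Lp_norm_def I_def integral_completion)
  then have "(I powr (1 / q)) powr q \<le> N powr q"
    using N q by (intro powr_mono2) auto
  then have I_le: "I \<le> N powr q"
    using q I0 by (simp add: powr_powr split: if_splits)
  define nu where "nu = density lborel (\<lambda>x. ennreal (\<bar>f x\<bar> powr q))"
  have sets_nu: "sets nu = sets borel" by (simp add: nu_def)
  have "emeasure nu UNIV = (\<integral>\<^sup>+x. ennreal (\<bar>f x\<bar> powr q) \<partial>lborel)"
    unfolding nu_def by (subst emeasure_density) auto
  also have "\<dots> = ennreal I"
    unfolding I_def by (rule nn_integral_eq_integral[OF int]) simp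
  finally have nuU: "emeasure nu UNIV = ennreal I" .
  have fin: "finite_measure nu"
    by (rule finite_measureI) (simp add: nu_def[symmetric] nuU, simp add: nu_def nuU[unfolded nu_def])
  interpret nu: finite_measure nu by fact
  obtain U where U: "open U" "{x. \<exists>r>0. s * r ^ DIM('a) < measure nu (cball x r)} \<subseteq> U"
    "emeasure lborel U \<le> ennreal (5 ^ DIM('a) * ?\<omega> / s) * emeasure nu UNIV"
    by (rule maximal_function_weak_type[OF sets_nu fin s])
  define E where "E = {x \<in> UNIV. 1 \<le> ennreal (1 / s) * ennreal (\<bar>f x\<bar> powr q)}"
  have "I / s \<le> m"
    using I_le N m by (simp add: s_def field_simps)
  then have Is: "ennreal (1 / s) * ennreal I \<le> ennreal m"
    using s I0 by (simp add: ennreal_mult[symmetric] ennreal_leI)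
  have "emeasure lborel E \<le> ennreal (1 / s) * (\<integral>\<^sup>+x. ennreal (\<bar>f x\<bar> powr q) * indicator UNIV x \<partial>lborel)"
    unfolding E_def by (rule nn_integral_Markov_inequality) auto
  also have "(\<integral>\<^sup>+x. ennreal (\<bar>f x\<bar> powr q) * indicator UNIV x \<partial>lborel) = ennreal I"
    using nn_integral_eq_integral[OF int] by (simp add: I_def)
  finally have E_le: "emeasure lborel E \<le> ennreal m"
    using Is by (rule order_trans)
  have U_le: "emeasure lborel U \<le> ennreal (5 ^ DIM('a) * ?\<omega> * m)"
  proof -
    have "ennreal (5 ^ DIM('a) * ?\<omega> / s) * emeasure nu UNIV = ennreal (5 ^ DIM('a) * ?\<omega>) * (ennreal (1 / s) * ennreal I)"
      using s by (simp add: nuU mult.assoc[symmetric] ennreal_mult[symmetric])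
    also have "\<dots> \<le> ennreal (5 ^ DIM('a) * ?\<omega>) * ennreal m"
      by (intro mult_left_mono Is) simp
    finally show ?thesis using U(3) m by (simp add: ennreal_mult)
  qed
  show ?thesis
  proof (rule that[of "U \<union> E"])
    show "U \<union> E \<in> sets borel" using U(1) by (auto simp: E_def)
    have "emeasure lborel (U \<union> E) \<le> emeasure lborel U + emeasure lborel E"
      using U(1) by (intro emeasure_subadditive) (auto simp: E_def)
    also have "\<dots> \<le> ennreal (5 ^ DIM('a) * ?\<omega> * m) + ennreal m"
      by (intro add_mono U_le E_le)
    also have "\<dots> = ennreal ((5 ^ DIM('a) * ?\<omega> + 1) * m)"
      using m by (subst ennreal_plus[symmetric]) (auto simp: distrib_right)
    finally show "emeasure lborel (U \<union> E) \<le> ennreal ((5 ^ DIM('a) * ?\<omega> + 1) * m)" .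
    show "AE x in lborel. x \<notin> U \<union> E \<longrightarrow> \<bar>f x\<bar> \<le> a \<and>
       (\<forall>\<rho>>0. (\<integral>\<^sup>+h. ennreal \<bar>f (x + h)\<bar> * indicator (ball 0 \<rho>) h \<partial>lborel)
          \<le> ennreal ((?\<omega> + 1) * a * \<rho> ^ DIM('a)))"
    proof (rule AE_I2, intro impI conjI allI)
      fix x assume x: "x \<notin> U \<union> E"
      then have "ennreal (1 / s) * ennreal (\<bar>f x\<bar> powr q) < ennreal 1"
        by (simp add: E_def not_le)
      also have "ennreal (1 / s) * ennreal (\<bar>f x\<bar> powr q) = ennreal (1 / s * \<bar>f x\<bar> powr q)"
        using s by (intro ennreal_mult[symmetric]) auto
      finally have "1 / s * \<bar>f x\<bar> powr q < 1"
        using s by (subst (asm) ennreal_less_iff) auto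
      then have "\<bar>f x\<bar> powr q \<le> a powr q"
        using s by (simp add: aq)
      then show "\<bar>f x\<bar> \<le> a"
        using powr_less_mono2[of q a "\<bar>f x\<bar>"] q a(2) by (smt (verit))
    next
      fix x and \<rho> :: real assume x: "x \<notin> U \<union> E" and \<rho>: "0 < \<rho>"
      have "\<not> s * \<rho> ^ DIM('a) < measure nu (cball x \<rho>)" using x U(2) \<rho> by auto
      then have nu_le: "emeasure nu (cball x \<rho>) \<le> ennreal (s * \<rho> ^ DIM('a))"
        by (simp add: nu.emeasure_eq_measure ennreal_leI)
      have "(\<integral>\<^sup>+h. ennreal \<bar>f (x + h)\<bar> * indicator (ball 0 \<rho>) h \<partial>lborel)
         = (\<integral>\<^sup>+h. ennreal \<bar>f (x + h)\<bar> * indicator (ball x \<rho>) (x + h) \<partial>lborel)"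
        by (intro nn_integral_cong) (auto simp: dist_norm split: split_indicator)
      also have "\<dots> = (\<integral>\<^sup>+y. ennreal \<bar>f y\<bar> * indicator (ball x \<rho>) y \<partial>lborel)"
        by (rule nn_integral_lborel_translate[where g="\<lambda>y. ennreal \<bar>f y\<bar> * indicator (ball x \<rho>) y"]) measurable
      \<comment> \<open>\<open>abs_le_add_powr\<close> takes the place of Hoelder's inequality: it
        passes from averages of |f|^q to averages of |f|. Because s = a^q, the second term
        contributes again the order a \<rho>^n.\<close>
      also have "\<dots> \<le> (\<integral>\<^sup>+y. ennreal a * indicator (ball x \<rho>) y + ennreal (a powr (1 - q)) * (ennreal (\<bar>f y\<bar> powr q) * indicator (cball x \<rho>) y) \<partial>lborel)"
      proof (rule nn_integral_mono)
        fix y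
        have "ennreal \<bar>f y\<bar> \<le> ennreal (a + a powr (1 - q) * \<bar>f y\<bar> powr q)"
          by (intro ennreal_leI abs_le_add_powr a q)
        also have "\<dots> = ennreal a + ennreal (a powr (1 - q)) * ennreal (\<bar>f y\<bar> powr q)"
          using a(2) by (subst ennreal_plus) (auto simp: ennreal_mult)
        finally show "ennreal \<bar>f y\<bar> * indicator (ball x \<rho>) y \<le> ennreal a * indicator (ball x \<rho>) y
            + ennreal (a powr (1 - q)) * (ennreal (\<bar>f y\<bar> powr q) * indicator (cball x \<rho>) y)"
          by (auto split: split_indicator)
      qed
      also have "\<dots> = ennreal a * emeasure lborel (ball x \<rho>) + ennreal (a powr (1 - q)) * emeasure nu (cball x \<rho>)"
        unfolding nu_def by (subst nn_integral_add) (auto simp: nn_integral_cmult emeasure_density)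
      also have "\<dots> \<le> ennreal a * ennreal (?\<omega> * \<rho> ^ DIM('a)) + ennreal (a powr (1 - q)) * ennreal (s * \<rho> ^ DIM('a))"
        using \<rho> by (intro add_mono mult_left_mono nu_le) (auto simp: emeasure_ball)
      also have "\<dots> = ennreal (a * (?\<omega> * \<rho> ^ DIM('a)) + a powr (1 - q) * (s * \<rho> ^ DIM('a)))"
        using a(2) s \<rho> by (simp add: ennreal_mult)
      also have "a powr (1 - q) * (s * \<rho> ^ DIM('a)) = a * \<rho> ^ DIM('a)"
        using a(2) by (simp add: aq[symmetric] mult.assoc[symmetric] powr_add[symmetric])
      also have "a * (?\<omega> * \<rho> ^ DIM('a)) + a * \<rho> ^ DIM('a) = (?\<omega> + 1) * a * \<rho> ^ DIM('a)"
        by (simp add: algebra_simps)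
      finally show "(\<integral>\<^sup>+h. ennreal \<bar>f (x + h)\<bar> * indicator (ball 0 \<rho>) h \<partial>lborel)
          \<le> ennreal ((?\<omega> + 1) * a * \<rho> ^ DIM('a))" .
    qed
  qed
next
  case PInf
  let ?\<omega> = "unit_ball_vol (real DIM('a))"
  have a: "a = N" using m PInf by (simp add: a_def inv_exponent_def)
  have ne: "{C. 0 \<le> C \<and> (AE x in lebesgue. \<bar>f x\<bar> \<le> C)} \<noteq> {}"
    using essential_bounds_nonempty Lp PInf by blast
  \<comment> \<open>The strict inequality with \<open>N\<close> produces an actual essential bound
    below \<open>N\<close>, so attainment of the infimum is not at issue.\<close>
  have "Inf {C. 0 \<le> C \<and> (AE x in lebesgue. \<bar>f x\<bar> \<le> C)} < N"
    using N PInf by (simp add: Lp_norm_def)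
  from cInf_lessD[OF ne this] obtain C where "C < N" "AE x in lebesgue. \<bar>f x\<bar> \<le> C" by auto
  then have AE: "AE x in lborel. \<bar>f x\<bar> \<le> N"
    by (auto simp: AE_completion_iff elim!: eventually_mono)
  show ?thesis
  proof (rule that[of "{}"])
    show "AE x in lborel. x \<notin> {} \<longrightarrow> \<bar>f x\<bar> \<le> a \<and>
       (\<forall>\<rho>>0. (\<integral>\<^sup>+h. ennreal \<bar>f (x + h)\<bar> * indicator (ball 0 \<rho>) h \<partial>lborel)
          \<le> ennreal ((?\<omega> + 1) * a * \<rho> ^ DIM('a)))"
      using AE
    proof eventually_elim
      case (elim x)
      have "(\<integral>\<^sup>+h. ennreal \<bar>f (x + h)\<bar> * indicator (ball 0 \<rho>) h \<partial>lborel)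
          \<le> ennreal ((?\<omega> + 1) * a * \<rho> ^ DIM('a))" if \<rho>: "0 < \<rho>" for \<rho>
      proof -
        have "(\<integral>\<^sup>+h. ennreal \<bar>f (x + h)\<bar> * indicator (ball 0 \<rho>) h \<partial>lborel)
           \<le> (\<integral>\<^sup>+h. ennreal N * indicator (ball (0::'a) \<rho>) h \<partial>lborel)"
          using AE_lborel_translate[OF AE, of x]
          by (intro nn_integral_mono_AE) (erule eventually_mono, auto intro!: ennreal_leI split: split_indicator)
        also have "\<dots> = ennreal N * ennreal (?\<omega> * \<rho> ^ DIM('a))"
          using \<rho> by (simp add: nn_integral_cmult_indicator emeasure_ball)
        also have "\<dots> = ennreal (N * (?\<omega> * \<rho> ^ DIM('a)))"
          using N \<rho> by (intro ennreal_mult[symmetric]) auto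
        also have "\<dots> \<le> ennreal ((?\<omega> + 1) * a * \<rho> ^ DIM('a))"
          using N \<rho> by (intro ennreal_leI) (simp add: a algebra_simps)
        finally show ?thesis .
      qed
      with elim show ?case by (simp add: a)
    qed
  qed auto
qed (use p in auto)

definition osc_const :: "nat \<Rightarrow> real" where
  "osc_const n = real n * exp 2 * 4 ^ n"

text \<open>The constant of \<open>frac_D_pointwise\<close> with K the oscillation constant and L =
  \<omega> + 1, where \<omega> is the volume of the unit ball.\<close>

definition frac_const :: "nat \<Rightarrow> real \<Rightarrow> real" where
  "frac_const n \<alpha> = osc_const n * 2 powr (real n + 1) * (1 / 2) powr (1 - \<alpha>) / (1 - (1 / 2) powr (1 - \<alpha>))
     + (unit_ball_vol n + 1 + unit_ball_vol n) * 2 powr real n / (1 - 2 powr (- \<alpha>))"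

text \<open>The first summand bounds the bad set of \<open>lam\<close>, whose mass carries the
  factor n; the bracket bounds the set from the L^p part.\<close>

definition cover_const :: "nat \<Rightarrow> real" where
  "cover_const n = 5 ^ n * unit_ball_vol n * real n + (5 ^ n * unit_ball_vol n + 1)"

lemma frac_const_pos:
  assumes "0 < \<alpha>" "\<alpha> < 1" shows "0 < frac_const n \<alpha>"
proof -
  have "(1 / 2) powr (1 - \<alpha>) < (1::real)" using powr_less_mono2[of "1 - \<alpha>" "1 / 2" 1] assms by simp
  moreover have "2 powr (- \<alpha>) < (1::real)" using powr_less_mono[of "- \<alpha>" 0 2] assms by simp
  moreover have "0 < unit_ball_vol (real n) + 1 + unit_ball_vol (real n)"
    using unit_ball_vol_nonneg[of "real n"] by linarith
  ultimately show ?thesis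
    unfolding frac_const_def osc_const_def
    by (intro add_nonneg_pos divide_pos_pos divide_nonneg_pos mult_nonneg_nonneg mult_pos_pos) auto
qed

lemma cover_const_pos: "0 < cover_const n"
proof -
  have "0 \<le> 5 ^ n * unit_ball_vol (real n) * real n" "0 \<le> 5 ^ n * unit_ball_vol (real n)"
    by simp_all
  then show ?thesis unfolding cover_const_def by linarith
qed

text \<open>With B = V / m the weak-type bound for \<open>lam\<close> is of order m, the same order
  as the exceptional set for \<open>f\<close>. A single parameter thus controls both, and off their
  union the pointwise bound applies.\<close>

lemma frac_D_exceptional_set:
  fixes f :: "'a::euclidean_space \<Rightarrow> real"
  assumes \<alpha>: "0 < \<alpha>" "\<alpha> < 1" and p: "1 \<le> p"
    and f: "f \<in> borel_measurable borel" and Lp: "in_Lp p f"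
    and lam: "sets lam = sets borel" "finite_measure lam"
    and grad: "\<And>e y b. 0 < e \<Longrightarrow> b \<in> Basis \<Longrightarrow>
        \<bar>\<integral>z. f z * partial_deriv (bump e y) b z \<partial>lborel\<bar> \<le> measure lam (cball y e)"
    and N: "Lp_norm p f < N" "0 < N"
    and V: "emeasure lam UNIV \<le> of_nat DIM('a) * ennreal V" "0 < V" and m: "0 < m"
  obtains W where "W \<in> sets borel" "emeasure lborel W \<le> ennreal (cover_const DIM('a) * m)"
    "AE x in lborel. x \<notin> W \<longrightarrow> frac_D \<alpha> f x \<le>
       ennreal (frac_const DIM('a) \<alpha> * (N * m powr (- inv_exponent p)) powr (1 - \<alpha>) * (V / m) powr \<alpha>)"
proof -
  let ?\<omega> = "unit_ball_vol (real DIM('a))"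
  define A where "A = N * m powr (- inv_exponent p)"
  define B where "B = V / m"
  have A: "0 < A" and B: "0 < B" using N V m by (auto simp: A_def B_def)
  obtain W1 where W1: "W1 \<in> sets borel"
    "emeasure lborel W1 \<le> ennreal ((5 ^ DIM('a) * ?\<omega> + 1) * m)"
    "AE x in lborel. x \<notin> W1 \<longrightarrow> \<bar>f x\<bar> \<le> A \<and>
       (\<forall>\<rho>>0. (\<integral>\<^sup>+h. ennreal \<bar>f (x + h)\<bar> * indicator (ball 0 \<rho>) h \<partial>lborel)
          \<le> ennreal ((?\<omega> + 1) * A * \<rho> ^ DIM('a)))"
    unfolding A_def by (rule Lp_exceptional_set[OF f p Lp N m])
  obtain U where U: "open U" "{x. \<exists>r>0. B * r ^ DIM('a) < measure lam (cball x r)} \<subseteq> U"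
    "emeasure lborel U \<le> ennreal (5 ^ DIM('a) * ?\<omega> / B) * emeasure lam UNIV"
    by (rule maximal_function_weak_type[OF lam B])
  have U_le: "emeasure lborel U \<le> ennreal (5 ^ DIM('a) * ?\<omega> * real DIM('a) * m)"
  proof -
    have "ennreal (5 ^ DIM('a) * ?\<omega> / B) * emeasure lam UNIV
       \<le> ennreal (5 ^ DIM('a) * ?\<omega> / B) * (ennreal (real DIM('a)) * ennreal V)"
      using V by (intro mult_left_mono) (auto simp: ennreal_of_nat_eq_real_of_nat)
    also have "\<dots> = ennreal (5 ^ DIM('a) * ?\<omega> / B * (real DIM('a) * V))"
    proof -
      have "ennreal (real DIM('a)) * ennreal V = ennreal (real DIM('a) * V)"
        using V by (intro ennreal_mult[symmetric]) auto
      moreover have "ennreal (5 ^ DIM('a) * ?\<omega> / B) * ennreal (real DIM('a) * V)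
          = ennreal (5 ^ DIM('a) * ?\<omega> / B * (real DIM('a) * V))"
        using V B by (intro ennreal_mult[symmetric]) auto
      ultimately show ?thesis by simp
    qed
    also have "5 ^ DIM('a) * ?\<omega> / B * (real DIM('a) * V) = 5 ^ DIM('a) * ?\<omega> * real DIM('a) * m"
      using V m by (simp add: B_def)
    finally show ?thesis using U(3) by (rule order_trans[rotated])
  qed
  show ?thesis
  proof (rule that[of "U \<union> W1"])
    show "U \<union> W1 \<in> sets borel" using U(1) W1(1) by auto
    have "emeasure lborel (U \<union> W1) \<le> emeasure lborel U + emeasure lborel W1"
      using U(1) W1(1) by (intro emeasure_subadditive) auto
    also have "\<dots> \<le> ennreal (5 ^ DIM('a) * ?\<omega> * real DIM('a) * m) + ennreal ((5 ^ DIM('a) * ?\<omega> + 1) * m)"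
      by (intro add_mono U_le W1)
    also have "\<dots> = ennreal (cover_const DIM('a) * m)"
      using m by (subst ennreal_plus[symmetric]) (auto simp: cover_const_def distrib_right)
    finally show "emeasure lborel (U \<union> W1) \<le> ennreal (cover_const DIM('a) * m)" .
    have li: "locally_integrable f" by (rule in_Lp_locally_integrable[OF f p Lp])
    show "AE x in lborel. x \<notin> U \<union> W1 \<longrightarrow> frac_D \<alpha> f x \<le>
       ennreal (frac_const DIM('a) \<alpha> * (N * m powr (- inv_exponent p)) powr (1 - \<alpha>) * (V / m) powr \<alpha>)"
      using AE_oscillation_bound[OF li lam grad, simplified] W1(3)
    proof eventually_elim
      case (elim x)
      show ?case
      proof
        assume x: "x \<notin> U \<union> W1"
        have "\<forall>r>0. measure lam (cball x r) \<le> B * r ^ DIM('a)"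
        proof (intro allI impI, rule ccontr)
          fix r :: real assume "0 < r" "\<not> measure lam (cball x r) \<le> B * r ^ DIM('a)"
          then have "x \<in> {x. \<exists>r>0. B * r ^ DIM('a) < measure lam (cball x r)}"
            by (auto simp: not_le)
          with U(2) x show False by blast
        qed
        with elim(1) have near: "(\<integral>\<^sup>+h. ennreal \<bar>f (x + h) - f x\<bar> * indicator (ball 0 \<rho>) h \<partial>lborel)
            \<le> ennreal (osc_const DIM('a) * B * \<rho> ^ (DIM('a) + 1))" if "0 < \<rho>" for \<rho>
          using that by (simp add: osc_const_def)
        show "frac_D \<alpha> f x \<le>
           ennreal (frac_const DIM('a) \<alpha> * (N * m powr (- inv_exponent p)) powr (1 - \<alpha>) * (V / m) powr \<alpha>)"
          unfolding frac_const_def A_def[symmetric] B_def[symmetric]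
          by (rule frac_D_pointwise[OF \<alpha> f A B _ _ near])
             (use elim(2) x in \<open>auto simp: osc_const_def\<close>)
      qed
    qed
  qed
qed

section \<open>Measurability and passage to a Borel representative\<close>

lemma borel_measurable_frac_D:
  fixes f :: "'a::euclidean_space \<Rightarrow> real"
  assumes [measurable]: "f \<in> borel_measurable borel"
  shows "frac_D \<alpha> f \<in> borel_measurable borel"
proof -
  have "(\<lambda>x. \<integral>\<^sup>+h. ennreal (\<bar>f (x + h) - f x\<bar> / norm h powr (real DIM('a) + \<alpha>)) \<partial>lborel) \<in> borel_measurable borel"
    by measurable
  then show ?thesis
    unfolding frac_D_def[abs_def] nn_integral_completion .
qed

text \<open>Preimages under \<open>h\<close> and \<open>g\<close> differ only inside a null set, all
  of whose subsets belong to the completion. This transfers measurability of the fractional operator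
  from a Borel representative to \<open>f\<close>.\<close>

lemma borel_measurable_completion_AE_eq:
  fixes g h :: "'a \<Rightarrow> ennreal"
  assumes g: "g \<in> borel_measurable M" and ae: "AE x in M. h x = g x"
  shows "h \<in> borel_measurable (completion M)"
proof (rule measurableI)
  fix S :: "ennreal set" assume S: "S \<in> sets borel"
  obtain N where N: "N \<in> null_sets M" "{x \<in> space M. h x \<noteq> g x} \<subseteq> N"
    using ae by (auto simp: eventually_ae_filter)
  have "h -` S \<inter> space M \<inter> N \<in> null_sets (completion M)"
    using N(1) by (intro null_sets_completion_subset[OF _ null_sets_completionI]) auto
  moreover have "(g -` S \<inter> space M) - N \<in> sets (completion M)"
    using measurable_sets[OF g S] N(1) by (intro sets_completionI_sets sets.Diff) auto
  moreover have "h -` S \<inter> space M = ((g -` S \<inter> space M) - N) \<union> (h -` S \<inter> space M \<inter> N)"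
    using N(2) by auto
  ultimately show "h -` S \<inter> space (completion M) \<in> sets (completion M)"
    by (metis null_setsD2 sets.Un space_completion)
qed simp

text \<open>Translates of null sets are null, so at each \<open>x\<close> with f x = g x the
  integrands agree for almost every \<open>h\<close>.\<close>

lemma frac_D_AE_eq:
  fixes f g :: "'a::euclidean_space \<Rightarrow> real"
  assumes ae: "AE x in lborel. f x = g x"
  shows "AE x in lborel. frac_D \<alpha> f x = frac_D \<alpha> g x"
  using ae
proof eventually_elim
  case (elim x)
  have "AE h in lborel. f (x + h) = g (x + h)" by (rule AE_lborel_translate[OF ae])
  then show ?case
    unfolding frac_D_def nn_integral_completion
    by (intro nn_integral_cong_AE) (erule eventually_mono, simp add: elim)
qed

lemma in_Lp_AE_eq:
  fixes f g :: "'a::euclidean_space \<Rightarrow> real"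
  assumes f: "f \<in> borel_measurable lebesgue" and g: "g \<in> borel_measurable borel"
    and ae: "AE x in lborel. f x = g x"
  shows "in_Lp p f \<longleftrightarrow> in_Lp p g" "Lp_norm p f = Lp_norm p g"
proof -
  have ae': "AE x in lebesgue. f x = g x" using ae by (rule AE_completion)
  have g': "g \<in> borel_measurable lebesgue" using g by (intro measurable_completion) simp
  have AE_iff: "(AE x in lebesgue. \<bar>f x\<bar> \<le> C) \<longleftrightarrow> (AE x in lebesgue. \<bar>g x\<bar> \<le> C)" for C
  proof (intro iffI)
    assume "AE x in lebesgue. \<bar>f x\<bar> \<le> C"
    with ae' show "AE x in lebesgue. \<bar>g x\<bar> \<le> C" by eventually_elim simp
  next
    assume "AE x in lebesgue. \<bar>g x\<bar> \<le> C"
    with ae' show "AE x in lebesgue. \<bar>f x\<bar> \<le> C" by eventually_elim simp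
  qed
  have ae_powr: "AE x in lebesgue. \<bar>f x\<bar> powr q = \<bar>g x\<bar> powr q" for q
    using ae' by eventually_elim simp
  have "integrable lebesgue (\<lambda>x. \<bar>f x\<bar> powr q) \<longleftrightarrow> integrable lebesgue (\<lambda>x. \<bar>g x\<bar> powr q)" for q
    using f g' ae_powr by (intro integrable_cong_AE) auto
  moreover have "(\<integral>x. \<bar>f x\<bar> powr q \<partial>lebesgue) = (\<integral>x. \<bar>g x\<bar> powr q \<partial>lebesgue)" for q
    using f g' ae_powr by (intro integral_cong_AE) auto
  ultimately show "in_Lp p f \<longleftrightarrow> in_Lp p g" "Lp_norm p f = Lp_norm p g"
    using f g' by (simp_all add: in_Lp_def Lp_norm_def AE_iff)
qed

lemma weak_level_bound:
  fixes g :: "'a::euclidean_space \<Rightarrow> ennreal"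
  assumes \<tau>: "0 < \<tau>" and \<sigma>: "0 < \<sigma>" and Q: "0 < Q" and \<Gamma>: "0 < \<Gamma>"
    and W: "\<And>m. 0 < m \<Longrightarrow> \<exists>W\<in>sets borel. emeasure lborel W \<le> ennreal (\<Gamma> * m) \<and>
        (AE x in lborel. x \<notin> W \<longrightarrow> g x \<le> ennreal (Q * m powr (- \<sigma>)))"
  shows "ennreal \<tau> * enn_powr (emeasure lebesgue {x. g x > ennreal \<tau>}) \<sigma> \<le> ennreal (\<Gamma> powr \<sigma> * Q)"
proof -
  \<comment> \<open>Solves Q m^(-\<sigma>) = \<tau>, so the superlevel set is contained in
    \<open>W\<close> up to a null set. In \<tau> (\<Gamma> m)^\<sigma> the level \<tau> then
    cancels.\<close>
  define m where "m = (Q / \<tau>) powr (1 / \<sigma>)"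
  have m: "0 < m" using Q \<tau> by (simp add: m_def)
  have m\<sigma>: "m powr \<sigma> = Q / \<tau>" using Q \<tau> \<sigma> by (simp add: m_def powr_powr)
  obtain W where W: "W \<in> sets borel" "emeasure lborel W \<le> ennreal (\<Gamma> * m)"
    "AE x in lborel. x \<notin> W \<longrightarrow> g x \<le> ennreal (Q * m powr (- \<sigma>))"
    using W[OF m] by blast
  have "Q * m powr (- \<sigma>) = \<tau>" using Q \<tau> by (simp add: powr_minus m\<sigma>)
  then have "AE x in lebesgue. x \<in> {x. g x > ennreal \<tau>} \<longrightarrow> x \<in> W"
    using AE_completion[OF W(3)] by (auto simp: not_less[symmetric] elim!: eventually_mono)
  then have "emeasure lebesgue {x. g x > ennreal \<tau>} \<le> emeasure lebesgue W"
    using W(1) by (intro emeasure_mono_AE) auto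
  also have "\<dots> \<le> ennreal (\<Gamma> * m)" using W(1,2) by simp
  finally have le: "emeasure lebesgue {x. g x > ennreal \<tau>} \<le> ennreal (\<Gamma> * m)" .
  let ?E = "emeasure lebesgue {x. g x > ennreal \<tau>}"
  have fin: "?E \<noteq> \<infinity>" using le by (auto simp: top_unique)
  have "enn2real ?E \<le> \<Gamma> * m"
    using le \<Gamma> m by (metis enn2real_leI mult_nonneg_nonneg less_imp_le)
  then have "enn2real ?E powr \<sigma> \<le> (\<Gamma> * m) powr \<sigma>"
    using \<sigma> by (intro powr_mono2) auto
  also have "\<dots> = \<Gamma> powr \<sigma> * Q / \<tau>" using \<Gamma> m by (simp add: powr_mult m\<sigma>)
  finally have "\<tau> * enn2real ?E powr \<sigma> \<le> \<Gamma> powr \<sigma> * Q"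
    using \<tau> by (simp add: field_simps)
  then show ?thesis
    using fin \<tau> by (simp add: enn_powr_def ennreal_mult'[symmetric] ennreal_leI)
qed

theorem theorem3p9:
  fixes \<alpha> :: real and p :: ereal
  assumes "0 < \<alpha>" and "\<alpha> < 1" and "1 \<le> p"
  shows "\<exists>c>0. \<forall>(f :: 'a::euclidean_space \<Rightarrow> real) mu. BV1p_with p f mu \<longrightarrow>
           in_weak_L (p_alpha \<alpha> p) (frac_D \<alpha> f) \<and>
           weak_Lnorm (p_alpha \<alpha> p) (frac_D \<alpha> f)
             \<le> ennreal (c * Lp_norm p f powr (1 - \<alpha>) * enn2real (total_variation mu) powr \<alpha>)"
proof -
  let ?n = "DIM('a)"
  define \<sigma> where "\<sigma> = 1 / p_alpha \<alpha> p"
  have \<sigma>: "0 < \<sigma>" "\<sigma> = (1 - \<alpha>) * inv_exponent p + \<alpha>"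
    using inverse_p_alpha[OF assms] by (simp_all add: \<sigma>_def)
  define C where "C = frac_const ?n \<alpha>"
  have C: "0 < C" unfolding C_def by (rule frac_const_pos[OF assms(1,2)])
  \<comment> \<open>The form \<Gamma>^\<sigma> Q of \<open>weak_level_bound\<close>, with the norm
    and the variation split off from Q.\<close>
  define c where "c = cover_const ?n powr \<sigma> * C"
  have c: "0 < c" using C cover_const_pos[of ?n] by (simp add: c_def)
  have main: "in_weak_L (p_alpha \<alpha> p) (frac_D \<alpha> f) \<and> weak_Lnorm (p_alpha \<alpha> p) (frac_D \<alpha> f)
      \<le> ennreal (c * Lp_norm p f powr (1 - \<alpha>) * enn2real (total_variation mu) powr \<alpha>)"
    if BV: "BV1p_with p f mu" for f :: "'a \<Rightarrow> real" and mu
  proof -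
    have Lpf: "in_Lp p f" and dg: "is_dist_gradient f mu" using BV by (auto simp: BV1p_with_def)
    have fm: "f \<in> borel_measurable lebesgue" using Lpf by (simp add: in_Lp_def)
    have fvm: "finite_vector_measure mu" using dg by (simp add: is_dist_gradient_def)
    \<comment> \<open>\<open>f\<close> is only Lebesgue measurable, while the translation and
      product arguments are carried out for Borel functions.\<close>
    obtain g where g0: "g \<in> borel_measurable lborel" and ae: "AE x in lborel. f x = g x"
      using completion_ex_borel_measurable_real[OF fm] by blast
    have g: "g \<in> borel_measurable borel" using g0 by simp
    have Lp: "in_Lp p g" "Lp_norm p g = Lp_norm p f"
      using in_Lp_AE_eq[OF fm g ae] Lpf by auto
    define V where "V = enn2real (total_variation mu)"
    have V0: "0 \<le> V" by (simp add: V_def)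
    have TV: "total_variation mu = ennreal V"
      using total_variation_finite[OF fvm] by (simp add: V_def)
    define N where "N = Lp_norm p f"
    have N0: "0 \<le> N"
      unfolding N_def by (rule Lp_norm_nonneg[OF Lpf])
    obtain lam where lam: "sets lam = sets (borel :: 'a measure)" "finite_measure lam"
      and lamV: "emeasure lam UNIV \<le> of_nat DIM('a) * total_variation mu"
      and dom: "\<forall>b\<in>Basis. \<forall>\<phi>\<in>borel_measurable borel. \<forall>B\<in>sets borel. \<forall>c\<ge>0.
        (\<forall>x. 0 \<le> \<phi> x \<and> \<phi> x \<le> c * indicator B x) \<longrightarrow>
        \<bar>(\<integral>x. \<phi> x \<partial>fst (mu b)) - (\<integral>x. \<phi> x \<partial>snd (mu b))\<bar> \<le> c * measure lam B"
      by (rule dominating_measure[OF fvm])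
    \<comment> \<open>Here the distributional gradient enters: the bump is a test function with
      values in [0, 1] vanishing outside the ball, so \<open>dom\<close> applies with constant
      1.\<close>
    have grad: "\<bar>\<integral>z. g z * partial_deriv (bump e y) b z \<partial>lborel\<bar> \<le> measure lam (cball y e)"
      if e: "0 < e" and b: "b \<in> Basis" for e and y b :: 'a
    proof -
      have pd: "partial_deriv (bump e y) b \<in> borel_measurable borel"
        unfolding partial_deriv_bump[abs_def] by measurable
      have "(\<integral>z. g z * partial_deriv (bump e y) b z \<partial>lborel) = (\<integral>z. g z * partial_deriv (bump e y) b z \<partial>lebesgue)"
        using g pd by (intro integral_completion[symmetric]) simp
      also have "\<dots> = (\<integral>z. f z * partial_deriv (bump e y) b z \<partial>lebesgue)"
      proof (rule integral_cong_AE)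
        show "AE z in lebesgue. g z * partial_deriv (bump e y) b z = f z * partial_deriv (bump e y) b z"
          using AE_completion[OF ae] by eventually_elim simp
        have "partial_deriv (bump e y) b \<in> borel_measurable lebesgue" "g \<in> borel_measurable lebesgue"
          using g pd by (auto intro!: measurable_completion)
        with fm show "(\<lambda>z. g z * partial_deriv (bump e y) b z) \<in> borel_measurable lebesgue"
          "(\<lambda>z. f z * partial_deriv (bump e y) b z) \<in> borel_measurable lebesgue"
          by simp_all
      qed
      also have "\<dots> = - ((\<integral>x. bump e y x \<partial>fst (mu b)) - (\<integral>x. bump e y x \<partial>snd (mu b)))"
        using dg test_fun_bump[OF e, of y] b by (auto simp: is_dist_gradient_def)
      finally have "\<bar>\<integral>z. g z * partial_deriv (bump e y) b z \<partial>lborel\<bar>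
          = \<bar>(\<integral>x. bump e y x \<partial>fst (mu b)) - (\<integral>x. bump e y x \<partial>snd (mu b))\<bar>"
        by (simp add: abs_minus_commute)
      also have "\<dots> \<le> 1 * measure lam (cball y e)"
      proof -
        have "0 \<le> bump e y x \<and> bump e y x \<le> 1 * indicator (cball y e) x" for x
          using bump_abs_le[OF e, of y x] bump_nonneg[of e y x]
          by (auto split: split_indicator_asm split_indicator)
        moreover have "bump e y \<in> borel_measurable borel" by measurable
        ultimately show ?thesis
          using dom[rule_format, of b "bump e y" "cball y e" 1] b by simp
      qed
      finally show ?thesis by simp
    qed
    have AEfg: "AE x in lborel. frac_D \<alpha> f x = frac_D \<alpha> g x"
      by (rule frac_D_AE_eq[OF ae])
    \<comment> \<open>Strictly larger \<open>N'\<close> and \<open>V'\<close> avoid dividing by zero when the norm or the variation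
      vanishes; they are removed by a limit below.\<close>
    have bound: "weak_Lnorm (p_alpha \<alpha> p) (frac_D \<alpha> f) \<le> ennreal (c * N' powr (1 - \<alpha>) * V' powr \<alpha>)"
      if N': "N < N'" and V': "V < V'" for N' V'
    proof -
      have pos: "0 < N'" "0 < V'" using that N0 V0 by auto
      define Q where "Q = C * N' powr (1 - \<alpha>) * V' powr \<alpha>"
      have Q: "0 < Q" using pos C by (simp add: Q_def)
      have W: "\<exists>W\<in>sets borel. emeasure lborel W \<le> ennreal (cover_const ?n * m) \<and>
          (AE x in lborel. x \<notin> W \<longrightarrow> frac_D \<alpha> f x \<le> ennreal (Q * m powr (- \<sigma>)))" if m: "0 < m" for m
      proof -
        have LV: "emeasure lam UNIV \<le> of_nat DIM('a) * ennreal V'"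
          by (rule order_trans[OF lamV[unfolded TV]]) (use V' in \<open>auto intro!: mult_left_mono ennreal_leI\<close>)
        have LN: "Lp_norm p g < N'" using N' Lp by (simp add: N_def)
        obtain W where W: "W \<in> sets borel" "emeasure lborel W \<le> ennreal (cover_const ?n * m)"
          "AE x in lborel. x \<notin> W \<longrightarrow> frac_D \<alpha> g x \<le>
             ennreal (frac_const ?n \<alpha> * (N' * m powr (- inv_exponent p)) powr (1 - \<alpha>) * (V' / m) powr \<alpha>)"
          by (rule frac_D_exceptional_set[OF assms g Lp(1) lam _ LN pos(1) LV pos(2) m])
             (rule grad that; assumption)+
        have "frac_const ?n \<alpha> * (N' * m powr (- inv_exponent p)) powr (1 - \<alpha>) * (V' / m) powr \<alpha>
            = Q * (m powr (- inv_exponent p * (1 - \<alpha>)) * m powr (- \<alpha>))"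
        proof -
          have "(N' * m powr (- inv_exponent p)) powr (1 - \<alpha>) = N' powr (1 - \<alpha>) * m powr (- inv_exponent p * (1 - \<alpha>))"
            using pos m by (simp add: powr_mult powr_powr)
          moreover have "(V' / m) powr \<alpha> = V' powr \<alpha> * m powr (- \<alpha>)"
            using pos m by (simp add: powr_divide powr_minus_divide)
          ultimately show ?thesis by (simp add: Q_def C_def ac_simps)
        qed
        also have "m powr (- inv_exponent p * (1 - \<alpha>)) * m powr (- \<alpha>) = m powr (- \<sigma>)"
        proof -
          \<comment> \<open>The powers of m from the two levels combine to exactly the reciprocal of
            \<open>p_alpha\<close>, so that \<open>weak_level_bound\<close> applies with the
            exponent of the weak norm.\<close>
          have "- inv_exponent p * (1 - \<alpha>) + - \<alpha> = - \<sigma>" unfolding \<sigma>(2) by (simp add: algebra_simps)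
          then show ?thesis by (simp only: powr_add[symmetric])
        qed
        finally have eq: "frac_const ?n \<alpha> * (N' * m powr (- inv_exponent p)) powr (1 - \<alpha>) * (V' / m) powr \<alpha>
            = Q * m powr (- \<sigma>)" .
        have "AE x in lborel. x \<notin> W \<longrightarrow> frac_D \<alpha> f x \<le> ennreal (Q * m powr (- \<sigma>))"
          using W(3)[unfolded eq] AEfg by eventually_elim simp
        with W(1,2) show ?thesis by (intro bexI[of _ W] conjI)
      qed
      show ?thesis
        unfolding weak_Lnorm_def \<sigma>_def[symmetric]
      proof (rule SUP_least)
        fix \<tau> :: real assume "\<tau> \<in> {0<..}"
        then have "ennreal \<tau> * enn_powr (emeasure lebesgue {x. frac_D \<alpha> f x > ennreal \<tau>}) \<sigma>
            \<le> ennreal (cover_const ?n powr \<sigma> * Q)"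
          by (intro weak_level_bound[OF _ \<sigma>(1) Q cover_const_pos W]) auto
        then show "ennreal \<tau> * enn_powr (emeasure lebesgue {x. frac_D \<alpha> f x > ennreal \<tau>}) \<sigma>
            \<le> ennreal (c * N' powr (1 - \<alpha>) * V' powr \<alpha>)"
          by (simp add: Q_def c_def mult.assoc)
      qed
    qed
    \<comment> \<open>The bases may tend to 0; \<open>powr\<close> is continuous there from the
      nonnegative side because both exponents 1 - \<alpha> and \<alpha> are positive.\<close>
    have "(\<lambda>k. ennreal (c * (N + 1 / real (Suc k)) powr (1 - \<alpha>) * (V + 1 / real (Suc k)) powr \<alpha>))
        \<longlonglongrightarrow> ennreal (c * (N + 0) powr (1 - \<alpha>) * (V + 0) powr \<alpha>)"
      using assms N0 V0
      by (intro tendsto_ennrealI tendsto_mult tendsto_const tendsto_powr' tendsto_add LIMSEQ_Suc[OF lim_1_over_n])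
         (auto intro!: always_eventually)
    then have "weak_Lnorm (p_alpha \<alpha> p) (frac_D \<alpha> f) \<le> ennreal (c * (N + 0) powr (1 - \<alpha>) * (V + 0) powr \<alpha>)"
      by (rule LIMSEQ_le_const) (auto intro!: bound)
    then have weak: "weak_Lnorm (p_alpha \<alpha> p) (frac_D \<alpha> f) \<le> ennreal (c * N powr (1 - \<alpha>) * V powr \<alpha>)"
      by simp
    moreover have "frac_D \<alpha> f \<in> borel_measurable lebesgue"
      using borel_measurable_frac_D[OF g] AEfg by (intro borel_measurable_completion_AE_eq) auto
    ultimately show ?thesis
      unfolding in_weak_L_def N_def V_def by (auto intro: le_less_trans)
  qed
  with c show ?thesis by blast
qed

end
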